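(* Let $(\varGamma,C)$ be a split-step SUSYQW with anisotropic coin $C$, and for $\sharp\in\{\mathrm L,\mathrm R\}$ let $U_\sharp=\varGamma\,\big(\bigoplus_{x\in\mathbb Z}C(\sharp)\big)$, i.e. $\varGamma$ composed with the constant coin equal to $C(\sharp)$ at every site. Then the essential spectrum of $U=\varGamma C$ is $\sigma_{\mathrm{ess}}(U)=\sigma(U_{\mathrm L})\cup\sigma(U_{\mathrm R})$, and $\sigma(U_\sharp)=\{z\in\mathbb C:|z|=1,\ \operatorname{Re}z\in I_\sharp\}$, where $I_\sharp=\{\pm1\}$ if $C(\sharp)$ is trivial and $I_\sharp=[\,p\,a(\sharp)-|q\,b(\sharp)|,\ p\,a(\sharp)+|q\,b(\sharp)|\,]$ otherwise.
   Context: Let $L$ be the left shift $(L\Psi)(x)=\Psi(x+1)$ on $\ell^2(\mathbb Z)$. A split-step SUSYQW is $\varGamma=\begin{pmatrix} p & qL\\ \overline{q}L^* & -p\end{pmatrix}$, $C=\begin{pmatrix} a_1 & \overline{b}\\ b & a_2\end{pmatrix}$ on $\ell^2(\mathbb Z,\mathbb C^2)\cong\ell^2(\mathbb Z)\oplus\ell^2(\mathbb Z)$ with $p\in\mathbb R$, $q\in\mathbb C\setminus\{0\}$, $p^2+|q|^2=1$, real sequences $a_1,a_2$ and complex sequence $b$ with $a_j(x)^2+|b(x)|^2=1$, $b(x)(a_1(x)+a_2(x))=0$. $C$ is anisotropic if $C(\mathrm L)=\lim_{x\to-\infty}C(x)$ and $C(\mathrm R)=\lim_{x\to+\infty}C(x)$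 exist, where $C(x)=\begin{pmatrix} a_1(x)&\overline{b(x)}\\ b(x)&a_2(x)\end{pmatrix}$; $b(\sharp)$ denotes the lower-left entry of $C(\sharp)$. A $2\times 2$ unitary Hermitian matrix is trivial if it equals $\pm I$; if $C(\sharp)$ is nontrivial then $a_1(\sharp)=-a_2(\sharp)=:a(\sharp)$. *)

theory Defs
  imports "HOL-Analysis.Analysis"
begin

text \<open>States in l2(Z, C^2), represented as functions Z -> C x C
  (first component = upper component, second = lower component).\<close>
type_synonym state = "int \<Rightarrow> complex \<times> complex"

definition l2 :: "state set" where
  "l2 = {\<psi>. (\<lambda>x. (norm (\<psi> x))\<^sup>2) summable_on UNIV}"

definition csmult :: "complex \<Rightarrow> complex \<times> complex \<Rightarrow> complex \<times> complex" where
  "csmult z v = (z * fst v, z * snd v)"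

text \<open>Split-step shift operator Gamma = [[p, q L],[conj q L^*, -p]],
  with (L psi)(x) = psi(x+1), (L^* psi)(x) = psi(x-1).\<close>
definition Gam :: "real \<Rightarrow> complex \<Rightarrow> state \<Rightarrow> state" where
  "Gam p q \<psi> = (\<lambda>x. (complex_of_real p * fst (\<psi> x) + q * snd (\<psi> (x + 1)),
                     cnj q * fst (\<psi> (x - 1)) - complex_of_real p * snd (\<psi> x)))"

definition Coin :: "(int \<Rightarrow> real) \<Rightarrow> (int \<Rightarrow> real) \<Rightarrow> (int \<Rightarrow> complex) \<Rightarrow> state \<Rightarrow> state" where
  "Coin a1 a2 b \<psi> = (\<lambda>x. (complex_of_real (a1 x) * fst (\<psi> x) + cnj (b x) * snd (\<psi> x),
                          b x * fst (\<psi> x) + complex_of_real (a2 x) * snd (\<psi> x)))"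

text \<open>Spectrum of an operator T on l2: z such that T - z is not a bijection of l2
  (for bounded operators this is equivalent to non-invertibility in B(l2)).\<close>
definition spec :: "(state \<Rightarrow> state) \<Rightarrow> complex set" where
  "spec T = {z. \<not> bij_betw (\<lambda>\<psi> x. T \<psi> x - csmult z (\<psi> x)) l2 l2}"

definition eigenspace :: "(state \<Rightarrow> state) \<Rightarrow> complex \<Rightarrow> state set" where
  "eigenspace T z = {\<psi> \<in> l2. T \<psi> = (\<lambda>x. csmult z (\<psi> x))}"

definition fin_dim :: "state set \<Rightarrow> bool" where
  "fin_dim E \<longleftrightarrow> (\<exists>F. finite F \<and> (\<forall>\<psi>\<in>E. \<exists>c. \<psi> = (\<lambda>x. \<Sum>\<phi>\<in>F. csmult (c \<phi>) (\<phi> x))))"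

definition disc_spec :: "(state \<Rightarrow> state) \<Rightarrow> complex set" where
  "disc_spec T = {z \<in> spec T. (\<exists>e>0. ball z e \<inter> spec T = {z})
                 \<and> eigenspace T z \<noteq> {\<lambda>_. (0, 0)} \<and> fin_dim (eigenspace T z)}"

definition ess_spec :: "(state \<Rightarrow> state) \<Rightarrow> complex set" where
  "ess_spec T = spec T - disc_spec T"

definition trivial_coin :: "real \<Rightarrow> real \<Rightarrow> complex \<Rightarrow> bool" where
  "trivial_coin a1 a2 b \<longleftrightarrow> b = 0 \<and> ((a1 = 1 \<and> a2 = 1) \<or> (a1 = -1 \<and> a2 = -1))"

text \<open>The interval I for a limit coin with entries a1, a2, b (a = a1 in the nontrivial case).\<close>
definition I_set :: "real \<Rightarrow> complex \<Rightarrow> real \<Rightarrow> real \<Rightarrow> complex \<Rightarrow> real set" where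
  "I_set p q a1 a2 b = (if trivial_coin a1 a2 b then {-1, 1}
                        else {p * a1 - norm (q * b) .. p * a1 + norm (q * b)})"

end

theory Submission
  imports Defs "HOL-Library.Function_Algebras"
begin

text \<open>
  Weyl's criterion without functional calculus. Write \<open>T = U - z\<close> with \<open>|z| = 1\<close>.

  For a constant coin, \<open>U + U\<^sup>*\<close> is a scalar combination of shifts, so \<open>T\<close> is bounded below when
  \<open>Re z\<close> lies outside the band, while inside the band a truncated plane wave is an approximate
  eigenvector. Moved far to the left or right, the same truncated wave is an approximate eigenvector of
  the anisotropic walk.

  If \<open>z\<close> were isolated in the spectrum of \<open>U\<close>, then \<open>A = T\<^sup>* T\<close> would satisfy \<open>A\<^sup>2 \<ge> \<epsilon> A\<close>, and
  iterating \<open>x \<mapsto> x - A x / 4\<close> would move every approximate eigenvector to a nearby exact one; far-away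
  approximate eigenvectors then produce arbitrarily many independent eigenvectors.

  Conversely, if \<open>z\<close> is in neither limit spectrum, then \<open>T\<close> is bounded below on states that vanish on a
  large box, hence \<open>\<parallel>\<psi>\<parallel> \<le> C (\<parallel>T \<psi>\<parallel> + \<parallel>\<psi> restricted to the box\<parallel>)\<close>, and compactness of the unit ball of
  the finite-dimensional box makes \<open>z\<close> at most an isolated eigenvalue of finite multiplicity.
\<close>

section \<open>Unitary operators\<close>

text \<open>The spectrum is defined by failure of bijectivity, so each spectral statement is traded
  for a lower bound on T. For unitary U the trade is exact. T is normal, and a lower bound at z
  survives a small move off the circle, where inversion is elementary; conversely a bijective T is
  bounded below by uniform boundedness. The gap of A comes from a factorisation: for |w| = 1 and t =
  |w - 1|^2, the operator A - t equals (U - z w)(U - z cnj w) up to a unitary factor. Hence a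
  punctured neighbourhood of z free of spectrum of U gives A an interval (0, eps) free of spectrum.
  The band comes from the Fourier symbol of a nontrivial constant coin, a 2x2 unitary matrix with
  determinant 1 and trace 2 (p a + Re (q b omega)). A number z on the circle is an eigenvalue
  exactly when Re z = p a + Re (q b omega), and this quantity sweeps out the interval as omega runs
  over the unit circle. For a trivial coin the symbol has trace 0 and determinant -1, which leaves
  only z = 1 and z = -1.\<close>

lemma bij_perturbation:
  fixes S K :: "'a::banach \<Rightarrow> 'a"
  assumes bij: "bij S" and S: "\<And>x y. c * norm (x - y) \<le> norm (S x - S y)"
    and K: "\<And>x y. norm (K x - K y) \<le> d * norm (x - y)" and d: "0 \<le> d" "d < c"
  shows "bij (\<lambda>x. S x + K x)"
proof (rule bijI)
  show "inj (\<lambda>x. S x + K x)"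
  proof (rule injI)
    fix x y assume "S x + K x = S y + K y"
    then have "S x - S y = K y - K x" by (simp add: algebra_simps)
    then have "c * norm (x - y) \<le> d * norm (x - y)"
      using S[of x y] K[of y x] by (simp add: norm_minus_commute)
    then have "(c - d) * norm (x - y) \<le> 0" by (simp add: algebra_simps)
    then show "x = y" using d by (simp add: mult_le_0_iff)
  qed
  show "surj (\<lambda>x. S x + K x)"
  unfolding surj_def
  proof
    fix y
    \<comment> \<open>A solution of \<open>S x + K x = y\<close> is a fixed point of
      \<open>f\<close>. Since \<open>S\<close> expands by \<open>c\<close> and \<open>K\<close> has
      Lipschitz constant \<open>d\<close>, \<open>f\<close> contracts with factor d / c.\<close>
    define f where "f x = inv S (y - K x)" for x
    have Sf: "S (f x) = y - K x" for x
      using bij by (simp add: f_def surj_f_inv_f bij_is_surj)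
    have "\<exists>!x. f x = x"
    proof (rule banach_fix_type[of "d / c"])
      show "0 \<le> d / c" "d / c < 1" using d by auto
      show "\<forall>x z. dist (f x) (f z) \<le> d / c * dist x z"
      proof (intro allI)
        fix x z
        have "c * norm (f x - f z) \<le> norm (K x - K z)"
          using S[of "f x" "f z"] by (simp add: Sf norm_minus_commute)
        also have "\<dots> \<le> d * norm (x - z)" by (rule K)
        finally show "dist (f x) (f z) \<le> d / c * dist x z"
          using d by (simp add: dist_norm field_simps)
      qed
    qed
    then obtain x where "f x = x" by auto
    then have "S x + K x = y" using Sf[of x] by simp
    then show "\<exists>x. y = S x + K x" by blast
  qed
qed

text \<open>Sokal's proof of the uniform boundedness principle: step \<open>n\<close> moves the point by \<open>3\<^sup>-\<^sup>n\<close> in the direction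
  that increases \<open>|\<langle>u\<^sub>n, x\<rangle>|\<close>, and the remaining steps can undo at most half of the gain.\<close>

lemma pointwise_bounded_imp_norm_bounded:
  fixes u :: "nat \<Rightarrow> 'a::{real_inner,banach}"
  assumes "\<And>x. \<exists>B. \<forall>n. \<bar>inner (u n) x\<bar> \<le> B"
  shows "\<exists>B. \<forall>n. norm (u n) \<le> B"
proof (rule ccontr)
  assume "\<nexists>B. \<forall>n. norm (u n) \<le> B"
  \<comment> \<open>The growth rate 4 beats the step lengths 3^-n: the pairing with the limit point
    will be at least (4/3)^n / 2.\<close>
  then have "\<forall>m. \<exists>n. norm (u n) > 4 ^ m" by (meson not_le)
  then obtain k where k: "\<And>m. norm (u (k m)) > 4 ^ m" by metis
  define v where "v m = u (k m)" for m
  have v: "norm (v m) > 4 ^ m" for m using k by (simp add: v_def)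
  have v0: "norm (v m) > 0" for m using v[of m] by (meson less_trans zero_less_numeral zero_less_power)
  define e where "e n y = ((if inner (v n) y \<ge> 0 then 1 else -1) * (1/3) ^ n / norm (v n)) *\<^sub>R v n"
    for n y
  define x where "x = rec_nat 0 (\<lambda>n y. y + e n y)"
  have xS: "x (Suc n) = x n + e n (x n)" for n by (simp add: x_def)
  have ne: "norm (e n y) = (1/3) ^ n" for n y using v0[of n] by (simp add: e_def power_divide)
  have sm: "summable (\<lambda>n. norm (e n (x n)))" by (simp add: ne summable_geometric)
  then have sme: "summable (\<lambda>n. e n (x n))" by (rule summable_norm_cancel)
  define L where "L = (\<Sum>n. e n (x n))"
  have xsum: "x n = (\<Sum>i<n. e i (x i))" for n
    by (induction n) (simp_all add: xS, simp add: x_def)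
  have tail: "norm (L - x (Suc n)) \<le> (1/3)^n / 2" for n
  proof -
    have eq: "(\<lambda>i. norm (e (i + Suc n) (x (i + Suc n)))) = (\<lambda>i. (1/3)^Suc n * (1/3)^i)"
      unfolding ne by (rule ext) (simp add: power_add mult.commute)
    have "L - x (Suc n) = (\<Sum>i. e (i + Suc n) (x (i + Suc n)))"
      unfolding L_def xsum[of "Suc n"]
      by (subst suminf_split_initial_segment[OF sme, of "Suc n"]) (rule add_diff_cancel_right')
    also have "norm \<dots> \<le> (\<Sum>i. norm (e (i + Suc n) (x (i + Suc n))))"
      by (rule summable_norm) (rule summable_ignore_initial_segment[OF sm, of "Suc n"])
    also have "\<dots> = (1/3)^Suc n * (\<Sum>i. (1/3)^i)"
      unfolding eq by (rule suminf_mult) (rule summable_geometric, simp)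
    also have "(\<Sum>i. (1/3)^i) = (3/2::real)" by (subst suminf_geometric) simp_all
    finally show ?thesis by simp
  qed
  have big: "\<bar>inner (v n) (x (Suc n))\<bar> \<ge> (1/3)^n * norm (v n)" for n
  proof -
    have 1: "inner (v n) (e n (x n)) = (if inner (v n) (x n) \<ge> 0 then 1 else -1) * ((1/3)^n * norm (v n))"
      using v0[of n] by (simp add: e_def dot_square_norm power2_eq_square)
    have 2: "(1/3)^n * norm (v n) \<ge> 0" by simp
    show ?thesis unfolding xS inner_add_right 1 using 2
      by (cases "inner (v n) (x n) \<ge> 0"; linarith?) auto
  qed
  obtain B where B: "\<And>n. \<bar>inner (u n) L\<bar> \<le> B" using assms by blast
  have "(4/3)^n / 2 \<le> B" for n
  proof -
    have "\<bar>inner (v n) (L - x (Suc n))\<bar> \<le> norm (v n) * ((1/3)^n / 2)"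
      by (rule order_trans[OF Cauchy_Schwarz_ineq2]) (intro mult_left_mono tail norm_ge_zero)
    then have "\<bar>inner (v n) (L - x (Suc n))\<bar> \<le> (1/3)^n * norm (v n) / 2" by (simp add: mult.commute)
    moreover have "inner (v n) L = inner (v n) (x (Suc n)) + inner (v n) (L - x (Suc n))"
      by (simp add: inner_diff_right)
    ultimately have "\<bar>inner (v n) L\<bar> \<ge> (1/3)^n * norm (v n) / 2" using big[of n] by linarith
    moreover have "(1/3)^n * norm (v n) \<ge> (1/3)^n * 4^n" using v[of n] by (intro mult_left_mono) auto
    moreover have "(1/3)^n * 4^n = (4/3::real)^n" by (simp add: power_divide)
    ultimately show ?thesis using B[of "k n"] by (simp add: v_def)
  qed
  moreover obtain n where "(4/3::real)^n > 2 * B" using real_arch_pow[of "4/3" "2*B"] by auto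
  ultimately show False by (smt (verit) field_sum_of_halves)
qed

text \<open>The inner product is real and plays the part of the real part of a Hermitian one;
  complex scalars act as operators \<open>sc z\<close>. The last axiom then says that the adjoint of
  \<open>sc z\<close> is \<open>sc (cnj z)\<close>.\<close>

locale complex_scaling =
  fixes sc :: "complex \<Rightarrow> 'a::{real_inner,banach} \<Rightarrow> 'a"
  assumes sc_of_real: "sc (of_real r) x = r *\<^sub>R x"
    and sc_sc: "sc z (sc w x) = sc (z * w) x"
    and sc_add_left: "sc (z + w) x = sc z x + sc w x"
    and sc_add_right: "sc z (x + y) = sc z x + sc z y"
    and inner_sc_left: "inner (sc z x) y = inner x (sc (cnj z) y)"
begin

lemma sc_1 [simp]: "sc 1 x = x"
  using sc_of_real[of 1 x] by simp

lemma sc_0_left [simp]: "sc 0 x = 0"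
  using sc_of_real[of 0 x] by simp

lemma sc_minus_left: "sc (- z) x = - sc z x"
  using sc_add_left[of "- z" z x] by (simp add: eq_neg_iff_add_eq_0)

lemma sc_diff_left: "sc (z - w) x = sc z x - sc w x"
  using sc_add_left[of z "- w" x] by (simp add: sc_minus_left)

lemma sc_0_right [simp]: "sc z 0 = 0"
  using sc_add_right[of z 0 0] by simp

lemma sc_minus_right: "sc z (- x) = - sc z x"
  using sc_add_right[of z "- x" x] by (simp add: eq_neg_iff_add_eq_0)

lemma sc_diff_right: "sc z (x - y) = sc z x - sc z y"
  using sc_add_right[of z x "- y"] by (simp add: sc_minus_right)

lemma sc_scaleR: "sc z (r *\<^sub>R x) = r *\<^sub>R sc z x"
  by (simp add: sc_sc mult.commute flip: sc_of_real)

lemma norm_sc [simp]: "norm (sc z x) = cmod z * norm x"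
proof (rule power2_eq_imp_eq)
  have "(norm (sc z x))\<^sup>2 = inner x (sc (of_real ((cmod z)\<^sup>2)) x)"
    unfolding complex_norm_square by (simp add: power2_norm_eq_inner inner_sc_left sc_sc mult.commute)
  also have "\<dots> = (cmod z)\<^sup>2 * (norm x)\<^sup>2"
    unfolding sc_of_real by (simp add: power2_norm_eq_inner)
  finally show "(norm (sc z x))\<^sup>2 = (cmod z * norm x)\<^sup>2"
    by (simp add: power_mult_distrib)
qed simp_all

end

locale unitary_operator = complex_scaling sc
  for sc :: "complex \<Rightarrow> 'a::{real_inner,banach} \<Rightarrow> 'a" +
  fixes U V :: "'a \<Rightarrow> 'a"
  assumes U_add: "U (x + y) = U x + U y"
    and U_sc: "U (sc z x) = sc z (U x)"
    and norm_U [simp]: "norm (U x) = norm x"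
    and UV [simp]: "U (V x) = x" and VU [simp]: "V (U x) = x"
begin

lemma U_scaleR: "U (r *\<^sub>R x) = r *\<^sub>R U x"
  by (simp add: U_sc flip: sc_of_real)

lemma U_0 [simp]: "U 0 = 0"
  using U_add[of 0 0] by simp

lemma U_diff: "U (x - y) = U x - U y"
  using U_add[of "x - y" y] by (simp add: algebra_simps)

lemma V_diff: "V (x - y) = V x - V y"
  by (metis U_diff UV VU)

lemma V_sc: "V (sc z x) = sc z (V x)"
  by (metis U_sc UV VU)

lemma V_scaleR: "V (r *\<^sub>R x) = r *\<^sub>R V x"
  by (metis U_scaleR UV VU)

lemma norm_V [simp]: "norm (V x) = norm x"
  by (metis norm_U UV)

lemma inner_U_U: "inner (U x) (U y) = inner x y"
proof -
  have "(norm (v + w))\<^sup>2 = (norm v)\<^sup>2 + 2 * inner v w + (norm w)\<^sup>2" for v w :: 'a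
    by (simp add: power2_norm_eq_inner inner_add_left inner_add_right inner_commute)
  from this[of x y] this[of "U x" "U y"] show ?thesis by (simp flip: U_add)
qed

lemma inner_U_left: "inner (U x) y = inner x (V y)"
  using inner_U_U[of x "V y"] by simp

definition T :: "complex \<Rightarrow> 'a \<Rightarrow> 'a" where
  "T z x = U x - sc z x"

definition Tadj :: "complex \<Rightarrow> 'a \<Rightarrow> 'a" where
  "Tadj z x = V x - sc (cnj z) x"

definition bounded_below_at :: "complex \<Rightarrow> bool" where
  "bounded_below_at z \<longleftrightarrow> (\<exists>c>0. \<forall>x. c * norm x \<le> norm (T z x))"

lemma T_0 [simp]: "T z 0 = 0"
  by (simp add: T_def)

lemma T_add: "T z (x + y) = T z x + T z y"
  by (simp add: T_def U_add sc_add_right)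

lemma T_diff: "T z (x - y) = T z x - T z y"
  by (simp add: T_def U_diff sc_diff_right)

lemma T_scaleR: "T z (r *\<^sub>R x) = r *\<^sub>R T z x"
  by (simp add: T_def U_scaleR sc_scaleR scaleR_diff_right)

lemma T_sc: "T z (sc w x) = sc w (T z x)"
  by (simp add: T_def U_sc sc_diff_right sc_sc mult.commute)

lemma norm_T_le: "norm (T z x) \<le> (1 + cmod z) * norm x"
  unfolding T_def by (rule order_trans[OF norm_triangle_ineq4]) (simp add: algebra_simps)

lemma norm_Tadj_le: "norm (Tadj z x) \<le> (1 + cmod z) * norm x"
  unfolding Tadj_def by (rule order_trans[OF norm_triangle_ineq4]) (simp add: algebra_simps)

lemma bounded_linear_T: "bounded_linear (T z)"
  by (rule bounded_linear_intro[where K = "1 + cmod z"])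
    (auto simp: T_add T_scaleR mult.commute intro: order_trans[OF norm_T_le])

lemma inner_T_left: "inner (T z x) y = inner x (Tadj z y)"
  by (simp add: T_def Tadj_def inner_diff_left inner_diff_right inner_U_left inner_sc_left)

text \<open>This is normality of \<open>T z\<close>: \<open>U\<close>, its inverse \<open>V\<close>
  and the scalars all commute. It lets kernels and bounds pass between \<open>T z\<close> and its
  adjoint.\<close>

lemma norm_Tadj: "norm (Tadj z x) = norm (T z x)"
proof -
  have "Tadj z (T z x) = T z (Tadj z x)"
    by (simp add: T_def Tadj_def U_diff V_diff V_sc U_sc sc_diff_right sc_sc algebra_simps)
  then have "(norm (T z x))\<^sup>2 = inner x (T z (Tadj z x))"
    by (simp add: power2_norm_eq_inner inner_T_left)
  also have "\<dots> = (norm (Tadj z x))\<^sup>2"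
    by (simp add: power2_norm_eq_inner inner_T_left inner_commute[of x])
  finally show ?thesis by simp
qed

lemma T_bound_shift: "norm (T z x) \<ge> norm (T w x) - cmod (z - w) * norm x"
proof -
  have "T w x = T z x + sc (z - w) x" by (simp add: T_def sc_diff_left)
  then have "norm (T w x) \<le> norm (T z x) + cmod (z - w) * norm x"
    using norm_triangle_ineq[of "T z x" "sc (z - w) x"] by simp
  then show ?thesis by simp
qed

text \<open>\<open>U\<close> is isometric and \<open>z\<close> scales norms by |z|. The larger of
  the two is inverted and the smaller is treated as the perturbation.\<close>

lemma bij_T_off_circle:
  assumes "cmod z \<noteq> 1"
  shows "bij (T z)"
proof (cases "cmod z < 1")
  case True
  have "bij U" by (rule o_bij[of V]) auto
  then have "bij (\<lambda>x. U x + sc (- z) x)"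
    by (rule bij_perturbation[where c = 1 and d = "cmod z"])
      (use True in \<open>auto simp flip: U_diff sc_diff_right\<close>)
  then show ?thesis by (simp add: T_def[abs_def] sc_minus_left)
next
  case False
  then have z: "cmod z > 1" "z \<noteq> 0" using assms by auto
  have "bij (sc (- z))" by (rule o_bij[of "sc (- inverse z)"]) (use z in \<open>auto simp: sc_sc\<close>)
  then have "bij (\<lambda>x. sc (- z) x + U x)"
    by (rule bij_perturbation[where c = "cmod z" and d = 1])
      (use z in \<open>auto simp flip: U_diff sc_diff_right\<close>)
  then show ?thesis by (simp add: T_def[abs_def] sc_minus_left)
qed

text \<open>A point of the unit circle is a limit of points off the circle, where the inverse has a
  norm that is controlled by the same lower bound.\<close>

lemma bounded_below_imp_bij:
  assumes "bounded_below_at z"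
  shows "bij (T z)"
proof (cases "cmod z = 1")
  case True
  obtain c where c: "c > 0" "\<And>x. c * norm x \<le> norm (T z x)"
    using assms unfolding bounded_below_at_def by blast
  \<comment> \<open>The auxiliary point \<open>w\<close> lies on the ray through \<open>z\<close> at
    distance \<open>d\<close>, inside the circle because d <= 1/2. With d <= c/4 the bound at
    \<open>w\<close> is still at least c/2 > d, so adding back the difference \<open>w - z\<close>
    is an admissible perturbation.\<close>
  define d where "d = min (c / 4) (1 / 2)"
  define w where "w = of_real (1 - d) * z"
  have d: "0 < d" "d \<le> c / 4" "d \<le> 1/2" using c by (auto simp: d_def)
  have wz: "w - z = - of_real d * z" by (simp add: w_def algebra_simps)
  have cw: "cmod w = 1 - d" "cmod (w - z) = d" using d True unfolding wz by (auto simp: w_def norm_mult simp del: of_real_diff)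
  have lower: "(c / 2) * norm (x - y) \<le> norm (T w x - T w y)" for x y
  proof -
    have "norm (T w (x - y)) \<ge> c * norm (x - y) - d * norm (x - y)"
      using T_bound_shift[of z "x - y" w] c(2)[of "x - y"] unfolding cw(2) by linarith
    moreover have "d * norm (x - y) \<le> c / 4 * norm (x - y)" using d by (intro mult_right_mono) auto
    moreover have "0 \<le> c * norm (x - y)" using c(1) by simp
    ultimately show ?thesis by (simp add: T_diff)
  qed
  have "bij (\<lambda>x. T w x + sc (w - z) x)"
    by (rule bij_perturbation[OF bij_T_off_circle lower, where d = d])
      (use d c(1) cw in \<open>auto simp flip: sc_diff_right\<close>)
  then show ?thesis by (simp add: T_def[abs_def] sc_diff_left)
qed (rule bij_T_off_circle)

text \<open>Otherwise there are \<open>u n\<close> of unbounded norm with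
  \<open>norm (T z (u n)) = 1\<close>. By surjectivity every x is some \<open>T z v\<close>, and
  then the pairing of \<open>u n\<close> with x equals that of v with \<open>Tadj z (u n)\<close>, a
  unit vector by normality. So the \<open>u n\<close> are bounded pointwise, hence in norm.\<close>

lemma bij_imp_bounded_below:
  assumes "bij (T z)"
  shows "bounded_below_at z"
proof (rule ccontr)
  assume "\<not> bounded_below_at z"
  then have "\<exists>x. norm (T z x) < 1 / Suc n * norm x" for n
    unfolding bounded_below_at_def by (metis not_le of_nat_0_less_iff zero_less_Suc zero_less_divide_1_iff)
  then obtain y where y: "\<And>n. norm (T z (y n)) < 1 / Suc n * norm (y n)" by metis
  define u where "u n = (1 / norm (T z (y n))) *\<^sub>R y n" for n
  have y0: "y n \<noteq> 0" for n using y[of n] by auto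
  have Ty0: "norm (T z (y n)) > 0" for n
    using y0 assms T_0[of z] by (metis bij_pointE zero_less_norm_iff)
  have nTu: "norm (T z (u n)) = 1" for n using Ty0[of n] by (simp add: u_def T_scaleR)
  have "\<exists>B. \<forall>n. \<bar>inner (u n) x\<bar> \<le> B" for x
  proof -
    obtain v where v: "x = T z v" using assms by (metis bij_pointE)
    have "\<bar>inner (u n) x\<bar> \<le> norm v" for n
    proof -
      have "inner (u n) x = inner v (Tadj z (u n))" by (simp add: v inner_commute[of "u n"] inner_T_left)
      then show ?thesis using Cauchy_Schwarz_ineq2[of v "Tadj z (u n)"] by (simp add: norm_Tadj nTu)
    qed
    then show ?thesis by blast
  qed
  then obtain B where B: "\<And>n. norm (u n) \<le> B"
    using pointwise_bounded_imp_norm_bounded[of u] by blast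
  have "real (Suc n) \<le> B" for n
  proof -
    have "real (Suc n) * norm (T z (y n)) < norm (y n)" using y[of n] by (simp add: field_simps)
    then have "real (Suc n) < norm (u n)" using Ty0[of n] by (simp add: u_def field_simps)
    then show ?thesis using B[of n] by linarith
  qed
  moreover obtain n where "real n > B" using reals_Archimedean2 by blast
  ultimately show False by (smt (verit) of_nat_Suc)
qed

lemma bij_iff_bounded_below: "bij (T z) \<longleftrightarrow> bounded_below_at z"
  using bounded_below_imp_bij bij_imp_bounded_below by blast

end

section \<open>The spectral gap of \<open>A\<close> and approximation by exact kernel
  vectors\<close>

lemma norm_diff_scaleR_sq:
  fixes u v :: "'a::real_inner"
  shows "(norm (u - r *\<^sub>R v))\<^sup>2 = (norm u)\<^sup>2 - 2 * r * inner u v + r\<^sup>2 * (norm v)\<^sup>2"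
  unfolding power2_norm_eq_inner inner_diff_left inner_diff_right
  by (simp add: inner_commute[of v u] power2_eq_square algebra_simps)

context unitary_operator
begin

definition A :: "complex \<Rightarrow> 'a \<Rightarrow> 'a" where
  "A z x = Tadj z (T z x)"

lemma A_eq:
  assumes "cmod z = 1"
  shows "A z x = 2 *\<^sub>R x - sc (cnj z) (U x) - sc z (V x)"
proof -
  have "cnj z * z = 1" using assms by (simp add: complex_norm_square[symmetric] mult.commute)
  then show ?thesis
    by (simp add: A_def T_def Tadj_def V_diff V_sc sc_diff_right sc_sc scaleR_2 algebra_simps)
qed

lemma inner_A_left: "inner (A z x) y = inner (T z x) (T z y)"
  by (simp add: A_def inner_T_left inner_commute[of _ y] inner_commute[of _ "T z y"])

lemma inner_A_right: "inner x (A z y) = inner (T z x) (T z y)"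
  by (simp add: A_def inner_T_left)

lemma A_diff: "A z (x - y) = A z x - A z y"
  by (simp add: A_def T_diff Tadj_def V_diff sc_diff_right algebra_simps)

lemma A_scaleR: "A z (r *\<^sub>R x) = r *\<^sub>R A z x"
  by (simp add: A_def T_scaleR Tadj_def V_scaleR sc_scaleR algebra_simps)

lemma norm_A_le:
  assumes "cmod z = 1"
  shows "norm (A z x) \<le> 2 * norm (T z x)"
  using norm_Tadj_le[of z "T z x"] assms by (simp add: A_def)

text \<open>Multiplying \<open>A z - (2 - 2 Re w)\<close> by \<open>- z U\<close>, which preserves
  norms, gives the polynomial U^2 - 2 (Re w) z U + z^2. Its roots are \<open>z * w\<close> and
  \<open>z * cnj w\<close>.\<close>

lemma A_minus_factor:
  assumes "cmod z = 1" "cmod w = 1"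
  shows "norm (A z x - (2 - 2 * Re w) *\<^sub>R x) = norm (T (z * w) (T (z * cnj w) x))"
proof -
  have zz: "z * cnj z = 1" and ww: "w * cnj w = 1"
    using assms by (simp_all add: complex_norm_square[symmetric])
  have "T (z * w) (T (z * cnj w) x) = U (U x) - (sc (z * cnj w) (U x) + sc (z * w) (U x)) + sc (z * z * (w * cnj w)) x"
    by (simp add: T_def U_diff U_sc sc_diff_right sc_sc algebra_simps)
  also have "sc (z * cnj w) (U x) + sc (z * w) (U x) = sc (z * of_real (2 * Re w)) (U x)"
    by (simp add: sc_add_left[symmetric] distrib_left[symmetric] complex_add_cnj add.commute)
  finally have 1: "T (z * w) (T (z * cnj w) x) = U (U x) - sc (z * of_real (2 * Re w)) (U x) + sc (z * z) x"
    by (simp add: ww)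
  have "sc (- z) (U (A z x - (2 - 2 * Re w) *\<^sub>R x)) =
      sc (z * cnj z) (U (U x)) + sc (z * z) x - sc (z * of_real 2) (U x) + sc (z * of_real (2 - 2 * Re w)) (U x)"
    unfolding A_eq[OF assms(1)]
    by (simp add: U_diff U_scaleR U_sc sc_diff_right sc_sc sc_minus_left scaleR_conv_of_real
        sc_of_real[symmetric] del: of_real_diff of_real_mult of_real_numeral)
  also have "\<dots> = T (z * w) (T (z * cnj w) x)"
    unfolding 1 zz by (simp add: sc_diff_left sc_add_left algebra_simps)
  finally have "norm (T (z * w) (T (z * cnj w) x)) = norm (sc (- z) (U (A z x - (2 - 2 * Re w) *\<^sub>R x)))"
    by simp
  then show ?thesis using assms by simp
qed

lemma A_minus_bounded_below:
  assumes z: "cmod z = 1" and t: "0 < t" "t < 4" "t < e\<^sup>2" "e > 0"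
    and gap: "\<And>w. w \<noteq> z \<Longrightarrow> cmod (w - z) < e \<Longrightarrow> bounded_below_at w"
  shows "\<exists>c>0. \<forall>x. c * norm x \<le> norm (A z x - t *\<^sub>R x)"
proof -
  \<comment> \<open>\<open>s\<close> is the imaginary part of the unit number \<open>w\<close> with
    2 - 2 Re w = t, equivalently |w - 1|^2 = t. So t < e^2 puts \<open>z * w\<close> and
    \<open>z * cnj w\<close> within \<open>e\<close> of \<open>z\<close>, and t > 0 keeps them
    different from \<open>z\<close>.\<close>
  define s where "s = sqrt (t - t\<^sup>2 / 4)"
  have "t\<^sup>2 \<le> t * 4" using t by (simp add: power2_eq_square)
  then have s: "s\<^sup>2 = t - t\<^sup>2 / 4" by (simp add: s_def)
  define w where "w = Complex (1 - t / 2) s"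
  have "cmod w = sqrt 1" unfolding w_def complex_norm
    by (rule arg_cong[of _ _ sqrt]) (simp only: s, simp add: power2_eq_square field_simps)
  then have w: "cmod w = 1" by simp
  have Rew: "2 - 2 * Re w = t" by (simp add: w_def)
  have "cmod (w - 1) = sqrt t"
  proof -
    have "w - 1 = Complex (- t / 2) s" by (simp add: w_def complex_eq_iff)
    then have "cmod (w - 1) = sqrt ((- t / 2)\<^sup>2 + s\<^sup>2)" using complex_norm by metis
    also have "(- t / 2)\<^sup>2 + s\<^sup>2 = t" unfolding s by (simp add: power_divide)
    finally show ?thesis .
  qed
  moreover have "sqrt t < e" using t by (intro real_less_lsqrt) auto
  moreover have "w \<noteq> 1" using Rew t by auto
  moreover have "cmod (cnj w - 1) = cmod (w - 1)" by (metis complex_cnj_diff complex_cnj_one complex_mod_cnj)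
  moreover have "cnj w \<noteq> 1" using Rew t by auto
  moreover have "cmod (z * v - z) = cmod (v - 1)" for v
    using norm_mult[of z "v - 1"] z by (simp add: algebra_simps)
  moreover have "z \<noteq> 0" using z by auto
  ultimately have "bounded_below_at (z * w)" "bounded_below_at (z * cnj w)"
    by (auto intro!: gap)
  then obtain c d where c: "c > 0" "\<And>x. c * norm x \<le> norm (T (z * w) x)"
    and d: "d > 0" "\<And>x. d * norm x \<le> norm (T (z * cnj w) x)"
    unfolding bounded_below_at_def by blast
  have "c * d * norm x \<le> norm (A z x - t *\<^sub>R x)" for x
  proof -
    have "c * (d * norm x) \<le> c * norm (T (z * cnj w) x)" using c d by (intro mult_left_mono) auto
    also have "\<dots> \<le> norm (T (z * w) (T (z * cnj w) x))" by (rule c)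
    also have "\<dots> = norm (A z x - t *\<^sub>R x)" using A_minus_factor[OF z w, of x] Rew by simp
    finally show ?thesis by simp
  qed
  then show ?thesis using c d by (intro exI[of _ "c * d"]) auto
qed

text \<open>If the optimal lower bound \<open>m\<close> of \<open>B = A - s\<close> were less than \<open>s\<close>, then
  \<open>B\<^sup>2 - m\<^sup>2 = (B - m) (B + m) \<ge> 0\<close> would be bounded below, which would improve \<open>m\<close>.\<close>

lemma A_gap:
  assumes z: "cmod z = 1" and s: "s > 0"
    and bb: "\<And>t. 0 < t \<Longrightarrow> t < 2 * s \<Longrightarrow> \<exists>c>0. \<forall>x. c * norm x \<le> norm (A z x - t *\<^sub>R x)"
  shows "s * norm x \<le> norm (A z x - s *\<^sub>R x)"
proof (rule ccontr)
  assume x: "\<not> ?thesis"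
  define B where "B y = A z y - s *\<^sub>R y" for y
  have x0: "norm x > 0" using x by (auto simp: A_def Tadj_def)
  define M where "M = (\<lambda>y. norm (B y) / norm y) ` (- {0})"
  define m where "m = Inf M"
  have bdd: "bdd_below M" by (auto simp: M_def intro!: bdd_belowI[of _ 0])
  have ne: "M \<noteq> {}" using x0 by (auto simp: M_def)
  have m0: "m \<ge> 0" unfolding m_def by (rule cInf_greatest[OF ne]) (auto simp: M_def)
  have "m \<le> norm (B x) / norm x" unfolding m_def by (rule cInf_lower[OF _ bdd]) (use x0 in \<open>auto simp: M_def\<close>)
  also have "\<dots> < s" using x x0 by (simp add: B_def field_simps)
  finally have ms: "m < s" .
  have mle: "m * norm y \<le> norm (B y)" for y
  proof (cases "y = 0")
    case False
    then have "m \<le> norm (B y) / norm y" unfolding m_def by (intro cInf_lower[OF _ bdd]) (auto simp: M_def)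
    then show ?thesis using False by (simp add: field_simps)
  qed simp
  have B_diff: "B (y - w) = B y - B w" for y w by (simp add: B_def A_diff algebra_simps)
  have B_scaleR: "B (r *\<^sub>R y) = r *\<^sub>R B y" for r y by (simp add: B_def A_scaleR algebra_simps)
  have B_sym: "inner (B y) w = inner y (B w)" for y w
    by (simp add: B_def inner_diff_left inner_diff_right inner_A_left inner_A_right)
  have B_le: "norm (B y) \<le> (4 + s) * norm y" for y
  proof -
    have "norm (B y) \<le> norm (A z y) + s * norm y"
      unfolding B_def using norm_triangle_ineq4[of "A z y" "s *\<^sub>R y"] s by simp
    then show ?thesis using norm_A_le[OF z, of y] norm_T_le[of z y] z by (simp add: algebra_simps)
  qed
  define S where "S y = B (B y) - m\<^sup>2 *\<^sub>R y" for y
  \<comment> \<open>Since 0 <= m < s, both s + m and s - m lie in (0, 2 s), so the hypothesis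
    \<open>bb\<close> covers both factors B - m and B + m.\<close>
  obtain c1 c2 where c1: "c1 > 0" "\<And>y. c1 * norm y \<le> norm (B y - m *\<^sub>R y)"
    and c2: "c2 > 0" "\<And>y. c2 * norm y \<le> norm (B y + m *\<^sub>R y)"
  proof -
    obtain c1 where "c1 > 0" "\<And>y. c1 * norm y \<le> norm (A z y - (s + m) *\<^sub>R y)"
      using bb[of "s + m"] m0 ms s by auto
    moreover obtain c2 where "c2 > 0" "\<And>y. c2 * norm y \<le> norm (A z y - (s - m) *\<^sub>R y)"
      using bb[of "s - m"] m0 ms s by auto
    ultimately show ?thesis using that[of c1 c2] by (simp add: B_def algebra_simps)
  qed
  have S_eq: "S y = B (B y + m *\<^sub>R y) - m *\<^sub>R (B y + m *\<^sub>R y)" for y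
    using B_diff[of "B y" "(- m) *\<^sub>R y"]
    by (simp add: S_def B_scaleR[of "- m", simplified] scaleR_add_right power2_eq_square)
  define c where "c = c1 * c2"
  have c: "c > 0" using c1 c2 by (simp add: c_def)
  have S_ge: "c * norm y \<le> norm (S y)" for y
  proof -
    have "c1 * (c2 * norm y) \<le> c1 * norm (B y + m *\<^sub>R y)" using c1 c2 by (intro mult_left_mono) auto
    also have "\<dots> \<le> norm (S y)" unfolding S_eq by (rule c1)
    finally show ?thesis by (simp add: c_def)
  qed
  have S_form: "inner (S y) y = (norm (B y))\<^sup>2 - m\<^sup>2 * (norm y)\<^sup>2" for y
    by (simp add: S_def inner_diff_left B_sym power2_norm_eq_inner)
  have S_pos: "inner (S y) y \<ge> 0" for y
  proof -
    have "(m * norm y)\<^sup>2 \<le> (norm (B y))\<^sup>2" using mle[of y] m0 by (intro power_mono) auto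
    then show ?thesis by (simp add: S_form power_mult_distrib)
  qed
  have S_diff: "S (y - w) = S y - S w" for y w
    unfolding S_def B_diff scaleR_diff_right by (rule diff_diff_eq2[THEN trans]) simp
  have S_scaleR: "S (r *\<^sub>R y) = r *\<^sub>R S y" for r y
    unfolding S_def B_scaleR scaleR_diff_right by (simp add: mult.commute)
  define K where "K = (4 + s)\<^sup>2"
  have K: "K > 0" using s by (simp add: K_def)
  have S_le: "inner (S y) y \<le> K * (norm y)\<^sup>2" for y
  proof -
    have "(norm (B y))\<^sup>2 \<le> ((4 + s) * norm y)\<^sup>2" using B_le[of y] by (intro power_mono) auto
    moreover have "m\<^sup>2 * (norm y)\<^sup>2 \<ge> 0" by simp
    ultimately show ?thesis unfolding S_form K_def power_mult_distrib by linarith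
  qed
  have S_sym: "inner (S y) w = inner y (S w)" for y w
    by (simp add: S_def inner_diff_left inner_diff_right B_sym)
  \<comment> \<open>A symmetric \<open>S\<close> between 0 and \<open>K\<close> satisfies S^2 <= K
    S. This follows by evaluating the nonnegative form of \<open>S\<close> at y - S y / K. It turns
    the norm bound \<open>S_ge\<close> into a bound on the quadratic form.\<close>
  have key: "(norm (S y))\<^sup>2 \<le> K * inner (S y) y" for y
  proof -
    have "0 \<le> inner (S (y - (1 / K) *\<^sub>R S y)) (y - (1 / K) *\<^sub>R S y)" by (rule S_pos)
    also have "S (y - (1 / K) *\<^sub>R S y) = S y - (1 / K) *\<^sub>R S (S y)"
      by (simp only: S_diff S_scaleR)
    also have "inner (S y - (1 / K) *\<^sub>R S (S y)) (y - (1 / K) *\<^sub>R S y)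
        = inner (S y) y - 2 / K * (norm (S y))\<^sup>2 + (1 / K)\<^sup>2 * inner (S (S y)) (S y)"
      unfolding power2_norm_eq_inner
      by (simp add: inner_diff_left inner_diff_right S_sym[of "S y" y] power2_eq_square algebra_simps)
    also have "(1 / K)\<^sup>2 * inner (S (S y)) (S y) \<le> (1 / K)\<^sup>2 * (K * (norm (S y))\<^sup>2)"
      by (intro mult_left_mono S_le) simp
    finally have "0 \<le> inner (S y) y - 1 / K * (norm (S y))\<^sup>2"
      using K by (simp add: power2_eq_square)
    then show ?thesis using K by (simp add: field_simps)
  qed
  \<comment> \<open>Combining \<open>S_ge\<close>, \<open>key\<close> and \<open>S_form\<close>
    gives c^2 |y|^2 <= K (|B y|^2 - m^2 |y|^2), so m^2 can be raised by c^2 / K.\<close>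
  define m' where "m' = sqrt (m\<^sup>2 + c\<^sup>2 / K)"
  have "m' * norm y \<le> norm (B y)" for y
  proof (rule power2_le_imp_le)
    have "(c * norm y)\<^sup>2 \<le> (norm (S y))\<^sup>2" using S_ge[of y] c by (intro power_mono) auto
    also have "\<dots> \<le> K * ((norm (B y))\<^sup>2 - m\<^sup>2 * (norm y)\<^sup>2)" using key[of y] by (simp add: S_form)
    finally have "(m\<^sup>2 + c\<^sup>2 / K) * (norm y)\<^sup>2 \<le> (norm (B y))\<^sup>2"
      using K by (simp add: field_simps power_mult_distrib)
    then show "(m' * norm y)\<^sup>2 \<le> (norm (B y))\<^sup>2" using K by (simp add: m'_def power_mult_distrib)
  qed simp
  then have "m' \<le> norm (B y) / norm y" if "y \<noteq> 0" for y using that by (simp add: pos_le_divide_eq)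
  then have "m' \<le> m" unfolding m_def by (intro cInf_greatest[OF ne]) (auto simp: M_def)
  moreover have "m' > m" unfolding m'_def using m0 c K by (intro real_less_rsqrt) simp
  ultimately show False by simp
qed

text \<open>\<open>T z\<close> has norm at most 2, which is the reason for the step size 1/4 in
  \<open>f\<close>: it gives |T (f x)|^2 <= |T x|^2 - |A x|^2 / 4, and the gap turns this into
  contraction of |T x| by \<open>r\<close>. As each step moves x by at most |T x| / 2, the iterates
  converge to a kernel vector, and the geometric series yields the constant 1 / (2 (1 - r)).\<close>

lemma approximate_kernel_of_A_gap:
  assumes z: "cmod z = 1" and e: "0 < e" "e \<le> 4"
    and gap: "\<And>x. e * (norm (T z x))\<^sup>2 \<le> (norm (A z x))\<^sup>2"
  shows "\<exists>C. \<forall>x. \<exists>y. T z y = 0 \<and> norm (x - y) \<le> C * norm (T z x)"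
proof -
  define r where "r = sqrt (1 - e / 4)"
  have r: "0 \<le> r" "r < 1" "r\<^sup>2 = 1 - e / 4" using e by (auto simp: r_def)
  define f where "f x = x - (1/4) *\<^sub>R A z x" for x
  have Tf: "norm (T z (f x)) \<le> r * norm (T z x)" for x
  proof (rule power2_le_imp_le)
    have "(norm (T z (f x)))\<^sup>2 = (norm (T z x))\<^sup>2 - 1/2 * (norm (A z x))\<^sup>2 + 1/16 * (norm (T z (A z x)))\<^sup>2"
      unfolding f_def T_diff T_scaleR norm_diff_scaleR_sq inner_A_left[symmetric]
      by (simp add: power2_norm_eq_inner power_divide)
    also have "(norm (T z (A z x)))\<^sup>2 \<le> (2 * norm (A z x))\<^sup>2"
      using norm_T_le[of z "A z x"] z by (intro power_mono) auto
    finally have "(norm (T z (f x)))\<^sup>2 \<le> (norm (T z x))\<^sup>2 - 1/4 * (norm (A z x))\<^sup>2"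
      by (simp add: power_mult_distrib)
    also have "\<dots> \<le> (r * norm (T z x))\<^sup>2"
      using gap[of x] by (simp add: power_mult_distrib r algebra_simps)
    finally show "(norm (T z (f x)))\<^sup>2 \<le> (r * norm (T z x))\<^sup>2" .
  qed (use r in simp)
  have step: "norm (f x - x) \<le> 1/2 * norm (T z x)" for x
    using norm_A_le[OF z, of x] by (simp add: f_def)
  have "\<exists>y. T z y = 0 \<and> norm (x - y) \<le> 1 / (2 * (1 - r)) * norm (T z x)" for x
  proof -
    define u where "u n = (f ^^ n) x" for n
    have uS: "u (Suc n) = f (u n)" for n by (simp add: u_def)
    have Tu: "norm (T z (u n)) \<le> r ^ n * norm (T z x)" for n
    proof (induction n)
      case (Suc n)
      have "norm (T z (u (Suc n))) \<le> r * norm (T z (u n))" unfolding uS by (rule Tf)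
      also have "\<dots> \<le> r * (r ^ n * norm (T z x))" using Suc r by (intro mult_left_mono) auto
      finally show ?case by simp
    qed (simp add: u_def)
    have d: "norm (u (Suc n) - u n) \<le> (1/2 * norm (T z x)) * r ^ n" for n
      using step[of "u n"] Tu[of n] by (simp add: uS mult.commute)
    have geo: "summable (\<lambda>n. (1/2 * norm (T z x)) * r ^ n)"
      using r by (intro summable_mult summable_geometric) simp
    have sn: "summable (\<lambda>n. norm (u (Suc n) - u n))"
      by (rule summable_comparison_test'[OF geo]) (unfold real_norm_def abs_norm_cancel, rule d)
    then have sm: "summable (\<lambda>n. u (Suc n) - u n)" by (rule summable_norm_cancel)
    define l where "l = (\<Sum>n. u (Suc n) - u n)"
    have "(\<lambda>n. \<Sum>i<n. u (Suc i) - u i) \<longlonglongrightarrow> l"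
      using sm unfolding l_def by (rule summable_LIMSEQ)
    then have "(\<lambda>n. u n - x) \<longlonglongrightarrow> l" by (simp add: sum_lessThan_telescope) (simp add: u_def)
    then have "(\<lambda>n. u n - x + x) \<longlonglongrightarrow> l + x" by (intro tendsto_add tendsto_const)
    then have lim: "u \<longlonglongrightarrow> x + l" by (simp add: add.commute)
    have "(\<lambda>n. T z (u n)) \<longlonglongrightarrow> T z (x + l)"
      by (rule bounded_linear.tendsto[OF bounded_linear_T lim])
    moreover have "(\<lambda>n. T z (u n)) \<longlonglongrightarrow> 0"
    proof (rule Lim_null_comparison)
      show "\<forall>\<^sub>F n in sequentially. norm (T z (u n)) \<le> r ^ n * norm (T z x)" using Tu by simp
      show "(\<lambda>n. r ^ n * norm (T z x)) \<longlonglongrightarrow> 0"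
        using r by (intro tendsto_mult_left_zero LIMSEQ_realpow_zero) auto
    qed
    ultimately have "T z (x + l) = 0" using LIMSEQ_unique by blast
    moreover have "norm l \<le> 1 / (2 * (1 - r)) * norm (T z x)"
    proof -
      have "norm l \<le> (\<Sum>n. norm (u (Suc n) - u n))" unfolding l_def by (rule summable_norm[OF sn])
      also have "\<dots> \<le> (\<Sum>n. (1/2 * norm (T z x)) * r ^ n)" by (rule suminf_le[OF d sn geo])
      also have "\<dots> = (1/2 * norm (T z x)) * (1 / (1 - r))"
        using r by (subst suminf_mult) (auto simp: suminf_geometric summable_geometric)
      finally show ?thesis by (simp add: field_simps)
    qed
    ultimately show ?thesis by (intro exI[of _ "x + l"]) simp
  qed
  then show ?thesis by blast
qed

lemma isolated_imp_approximate_kernel: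
  assumes z: "cmod z = 1" and e: "e > 0"
    and gap: "\<And>w. w \<noteq> z \<Longrightarrow> cmod (w - z) < e \<Longrightarrow> bij (T w)"
  shows "\<exists>C. \<forall>x. \<exists>y. T z y = 0 \<and> norm (x - y) \<le> C * norm (T z x)"
proof -
  \<comment> \<open>The interval (0, 2 s) is the part of the gap of \<open>A\<close> certified by
    \<open>e\<close>, and \<open>s\<close> is its midpoint. Squaring |A x - s x| >= s |x| cancels
    s^2 |x|^2 and leaves |A x|^2 >= 2 s |T x|^2.\<close>
  define s where "s = min (e\<^sup>2) 4 / 2"
  have s: "s > 0" "2 * s \<le> e\<^sup>2" "2 * s \<le> 4" using e by (auto simp: s_def)
  have "2 * s * (norm (T z x))\<^sup>2 \<le> (norm (A z x))\<^sup>2" for x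
  proof -
    have "s * norm x \<le> norm (A z x - s *\<^sub>R x)"
      by (rule A_gap[OF z s(1)], rule A_minus_bounded_below[OF z, where e = e])
        (use s e gap bij_iff_bounded_below in auto)
    then have "(s * norm x)\<^sup>2 \<le> (norm (A z x - s *\<^sub>R x))\<^sup>2" using s by (intro power_mono) auto
    also have "\<dots> = (norm (A z x))\<^sup>2 - 2 * s * (norm (T z x))\<^sup>2 + (s * norm x)\<^sup>2"
      unfolding norm_diff_scaleR_sq inner_A_left by (simp add: power2_norm_eq_inner power_mult_distrib)
    finally show ?thesis by simp
  qed
  then show ?thesis by (intro approximate_kernel_of_A_gap[OF z, of "2 * s"]) (use s in auto)
qed

end

section \<open>The Hilbert space of states\<close>

lemma l2_zero: "(\<lambda>_. 0) \<in> l2"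
  by (simp add: l2_def)

text \<open>A type of square-summable states makes the abstract results on Banach and inner product
  spaces applicable. The spectral notions of the theorem speak of raw functions;
  \<open>spec_iff\<close> and \<open>eigenspace_eq\<close> transport them along
  \<open>app\<close>.\<close>

typedef ell2 = l2 morphisms app Abs_ell2
  using l2_zero by blast

lemma summable_app: "(\<lambda>x. (norm (app \<psi> x))\<^sup>2) summable_on UNIV"
  using app[of \<psi>] by (simp add: l2_def)

lemma ell2_eqI: "(\<And>x. app \<psi> x = app \<phi> x) \<Longrightarrow> \<psi> = \<phi>"
  by (metis app_inject ext)

lemma l2_dominated:
  assumes "\<psi> \<in> l2" "\<And>x. norm (\<phi> x) \<le> c * norm (\<psi> x)"
  shows "\<phi> \<in> l2"
proof -
  have "(\<lambda>x. c\<^sup>2 * (norm (\<psi> x))\<^sup>2) summable_on UNIV"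
    using assms(1) by (intro summable_on_cmult_right) (simp add: l2_def)
  then have "(\<lambda>x. (norm (\<phi> x))\<^sup>2) summable_on UNIV"
    by (rule summable_on_comparison_test)
      (use assms(2) in \<open>auto intro: power_mono simp flip: power_mult_distrib\<close>)
  then show ?thesis by (simp add: l2_def)
qed

lemma l2_add:
  assumes "\<psi> \<in> l2" "\<phi> \<in> l2"
  shows "(\<lambda>x. \<psi> x + \<phi> x) \<in> l2"
proof -
  have "(\<lambda>x. 2 * (norm (\<psi> x))\<^sup>2 + 2 * (norm (\<phi> x))\<^sup>2) summable_on UNIV"
    using assms by (intro summable_on_add summable_on_cmult_right) (auto simp: l2_def)
  then have "(\<lambda>x. (norm (\<psi> x + \<phi> x))\<^sup>2) summable_on UNIV"
  proof (rule summable_on_comparison_test)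
    fix x
    have "(norm (\<psi> x + \<phi> x))\<^sup>2 \<le> (norm (\<psi> x) + norm (\<phi> x))\<^sup>2"
      by (intro power_mono norm_triangle_ineq) simp
    also have "\<dots> \<le> 2 * (norm (\<psi> x))\<^sup>2 + 2 * (norm (\<phi> x))\<^sup>2"
      using sum_squares_bound[of "norm (\<psi> x)" "norm (\<phi> x)"] by (simp add: power2_sum)
    finally show "(norm (\<psi> x + \<phi> x))\<^sup>2 \<le> 2 * (norm (\<psi> x))\<^sup>2 + 2 * (norm (\<phi> x))\<^sup>2" .
  qed simp
  then show ?thesis by (simp add: l2_def)
qed

lemma l2_scaleR: "\<psi> \<in> l2 \<Longrightarrow> (\<lambda>x. r *\<^sub>R \<psi> x) \<in> l2"
  by (rule l2_dominated[of \<psi> _ "\<bar>r\<bar>"]) auto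

lemma norm_csmult: "norm (csmult z v) = cmod z * norm v"
  by (simp add: csmult_def norm_prod_def norm_mult power_mult_distrib real_sqrt_mult
      flip: distrib_left)

lemma l2_csmult: "\<psi> \<in> l2 \<Longrightarrow> (\<lambda>x. csmult z (\<psi> x)) \<in> l2"
  by (rule l2_dominated[of \<psi> _ "cmod z"]) (auto simp: norm_csmult)

lemma l2_inner_summable:
  assumes "\<psi> \<in> l2" "\<phi> \<in> l2"
  shows "(\<lambda>x. inner (\<psi> x) (\<phi> x)) summable_on UNIV"
proof (rule abs_summable_summable)
  have "(\<lambda>x. (norm (\<psi> x))\<^sup>2 + (norm (\<phi> x))\<^sup>2) summable_on UNIV"
    using assms by (intro summable_on_add) (auto simp: l2_def)
  then show "(\<lambda>x. norm (inner (\<psi> x) (\<phi> x))) summable_on UNIV"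
  proof (rule summable_on_comparison_test)
    fix x
    have "\<bar>inner (\<psi> x) (\<phi> x)\<bar> \<le> norm (\<psi> x) * norm (\<phi> x)" by (rule Cauchy_Schwarz_ineq2)
    moreover have "2 * (norm (\<psi> x) * norm (\<phi> x)) \<le> (norm (\<psi> x))\<^sup>2 + (norm (\<phi> x))\<^sup>2"
      using sum_squares_bound[of "norm (\<psi> x)" "norm (\<phi> x)"] by simp
    moreover have "0 \<le> norm (\<psi> x) * norm (\<phi> x)" by simp
    ultimately show "norm (inner (\<psi> x) (\<phi> x)) \<le> (norm (\<psi> x))\<^sup>2 + (norm (\<phi> x))\<^sup>2"
      by (simp only: real_norm_def)
  qed simp
qed

instantiation ell2 :: real_vector
begin

definition "0 = Abs_ell2 (\<lambda>_. 0)"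
definition "\<psi> + \<phi> = Abs_ell2 (\<lambda>x. app \<psi> x + app \<phi> x)"
definition "- \<psi> = Abs_ell2 (\<lambda>x. - app \<psi> x)"
definition "\<psi> - \<phi> = Abs_ell2 (\<lambda>x. app \<psi> x - app \<phi> x)"
definition "r *\<^sub>R \<psi> = Abs_ell2 (\<lambda>x. r *\<^sub>R app \<psi> x)"

lemma app_zero [simp]: "app 0 x = 0"
  by (simp add: zero_ell2_def Abs_ell2_inverse l2_zero)

lemma app_add [simp]: "app (\<psi> + \<phi>) x = app \<psi> x + app \<phi> x"
  by (simp add: plus_ell2_def Abs_ell2_inverse l2_add app)

lemma app_scaleR [simp]: "app (r *\<^sub>R \<psi>) x = r *\<^sub>R app \<psi> x"
  by (simp add: scaleR_ell2_def Abs_ell2_inverse l2_scaleR app)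

lemma app_uminus [simp]: "app (- \<psi>) x = - app \<psi> x"
  using l2_scaleR[OF app, of "- 1" \<psi>] by (simp add: uminus_ell2_def Abs_ell2_inverse)

lemma app_diff [simp]: "app (\<psi> - \<phi>) x = app \<psi> x - app \<phi> x"
  using l2_add[OF app l2_scaleR[OF app, of "- 1"], of \<psi> \<phi>]
  by (simp add: minus_ell2_def Abs_ell2_inverse)

instance
  by standard (auto intro!: ell2_eqI simp: algebra_simps)

end

instantiation ell2 :: real_inner
begin

definition inner_ell2_def: "inner \<psi> \<phi> = (\<Sum>\<^sub>\<infinity>x. inner (app \<psi> x) (app \<phi> x))"
definition norm_ell2_def: "norm (\<psi>::ell2) = sqrt (inner \<psi> \<psi>)"
definition dist_ell2_def: "dist (\<psi>::ell2) \<phi> = norm (\<psi> - \<phi>)"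
definition sgn_ell2_def: "sgn (\<psi>::ell2) = \<psi> /\<^sub>R norm \<psi>"
definition uniformity_ell2_def:
  "(uniformity :: (ell2 \<times> ell2) filter) = (INF e\<in>{0 <..}. principal {(x, y). dist x y < e})"
definition open_ell2_def:
  "open (S :: ell2 set) \<longleftrightarrow> (\<forall>x\<in>S. eventually (\<lambda>(x', y). x' = x \<longrightarrow> y \<in> S) uniformity)"

instance
proof
  fix \<psi> \<phi> w :: ell2 and r :: real and S :: "ell2 set"
  show "dist \<psi> \<phi> = norm (\<psi> - \<phi>)" by (rule dist_ell2_def)
  show "sgn \<psi> = \<psi> /\<^sub>R norm \<psi>" by (rule sgn_ell2_def)
  show "(uniformity :: (ell2 \<times> ell2) filter) = (INF e\<in>{0 <..}. principal {(x, y). dist x y < e})"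
    by (rule uniformity_ell2_def)
  show "open S \<longleftrightarrow> (\<forall>x\<in>S. eventually (\<lambda>(x', y). x' = x \<longrightarrow> y \<in> S) uniformity)"
    by (rule open_ell2_def)
  show "norm \<psi> = sqrt (inner \<psi> \<psi>)" by (rule norm_ell2_def)
  show "inner \<psi> \<phi> = inner \<phi> \<psi>" by (simp add: inner_ell2_def inner_commute)
  show "inner (\<psi> + \<phi>) w = inner \<psi> w + inner \<phi> w"
    by (simp add: inner_ell2_def inner_add_left infsum_add l2_inner_summable app)
  show "inner (r *\<^sub>R \<psi>) \<phi> = r * inner \<psi> \<phi>"
    by (simp add: inner_ell2_def infsum_cmult_right l2_inner_summable app)
  show "0 \<le> inner \<psi> \<psi>" by (auto simp: inner_ell2_def intro: infsum_nonneg)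
  show "inner \<psi> \<psi> = 0 \<longleftrightarrow> \<psi> = 0"
  proof
    assume 0: "inner \<psi> \<psi> = 0"
    have "inner (app \<psi> x) (app \<psi> x) = 0" for x
      by (rule nonneg_infsum_le_0D[where A = UNIV and f = "\<lambda>x. inner (app \<psi> x) (app \<psi> x)"])
        (use 0 in \<open>auto simp: inner_ell2_def l2_inner_summable app\<close>)
    then show "\<psi> = 0" by (intro ell2_eqI) simp
  qed (simp add: inner_ell2_def)
qed

end

lemma norm_ell2_sq: "(norm \<psi>)\<^sup>2 = (\<Sum>\<^sub>\<infinity>x. (norm (app \<psi> x))\<^sup>2)"
  by (simp add: power2_norm_eq_inner inner_ell2_def)

lemma has_sum_norm_ell2: "((\<lambda>x. (norm (app \<psi> x))\<^sup>2) has_sum (norm \<psi>)\<^sup>2) UNIV"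
  unfolding norm_ell2_sq by (rule has_sum_infsum[OF summable_app])

lemma norm_ell2_dominated:
  assumes "\<And>x. norm (app \<phi> x) \<le> c * norm (app \<psi> x)" "c \<ge> 0"
  shows "norm \<phi> \<le> c * norm \<psi>"
proof (rule power2_le_imp_le)
  show "(norm \<phi>)\<^sup>2 \<le> (c * norm \<psi>)\<^sup>2"
    unfolding power_mult_distrib
  proof (rule has_sum_mono[OF has_sum_norm_ell2 has_sum_cmult_right[OF has_sum_norm_ell2]])
    fix x show "(norm (app \<phi> x))\<^sup>2 \<le> c\<^sup>2 * (norm (app \<psi> x))\<^sup>2"
      using power_mono[OF assms(1)[of x], of 2] by (simp add: power_mult_distrib)
  qed
qed (use assms in simp)

lemma sum_norm_app_le: "finite F \<Longrightarrow> (\<Sum>x\<in>F. (norm (app \<psi> x))\<^sup>2) \<le> (norm \<psi>)\<^sup>2"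
  unfolding norm_ell2_sq by (rule finite_sum_le_infsum[OF summable_app]) auto

lemma norm_app_le: "norm (app \<psi> x) \<le> norm \<psi>"
  using sum_norm_app_le[of "{x}" \<psi>] by (simp add: power2_le_iff_abs_le)

lemma norm_le_if_finite_sums_le:
  assumes "\<And>F. finite F \<Longrightarrow> (\<Sum>x\<in>F. (norm (app \<psi> x))\<^sup>2) \<le> B\<^sup>2" "B \<ge> 0"
  shows "norm \<psi> \<le> B"
proof (rule power2_le_imp_le)
  show "(norm \<psi>)\<^sup>2 \<le> B\<^sup>2"
    unfolding norm_ell2_sq by (rule infsum_le_finite_sums[OF summable_app]) (use assms in auto)
qed (use assms in simp)

instance ell2 :: banach
proof
  fix X :: "nat \<Rightarrow> ell2" assume X: "Cauchy X"
  have "Cauchy (\<lambda>n. app (X n) x)" for x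
  proof (rule metric_CauchyI)
    fix e :: real assume "e > 0"
    then obtain N where N: "\<And>m n. m \<ge> N \<Longrightarrow> n \<ge> N \<Longrightarrow> dist (X m) (X n) < e"
      using metric_CauchyD[OF X] by blast
    have "dist (app (X m) x) (app (X n) x) \<le> dist (X m) (X n)" for m n
      using norm_app_le[of "X m - X n" x] by (simp add: dist_norm)
    then show "\<exists>N. \<forall>m\<ge>N. \<forall>n\<ge>N. dist (app (X m) x) (app (X n) x) < e"
      using N by (meson le_less_trans)
  qed
  then have "\<forall>x. \<exists>l. (\<lambda>n. app (X n) x) \<longlonglongrightarrow> l" using Cauchy_convergent_iff convergent_def by metis
  then obtain f where f: "\<And>x. (\<lambda>n. app (X n) x) \<longlonglongrightarrow> f x" by metis
  \<comment> \<open>The Cauchy estimate passes to the pointwise limit on each finite set of sites,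
    with an index that is independent of the set. This gives both membership of \<open>f\<close> in
    \<open>l2\<close> and convergence in norm.\<close>
  have close: "\<exists>N. \<forall>n\<ge>N. \<forall>F. finite F \<longrightarrow> (\<Sum>x\<in>F. (norm (app (X n) x - f x))\<^sup>2) \<le> e\<^sup>2"
    if e: "e > 0" for e
  proof -
    obtain N where N: "\<And>m n. m \<ge> N \<Longrightarrow> n \<ge> N \<Longrightarrow> dist (X m) (X n) < e"
      using metric_CauchyD[OF X e] by blast
    have "(\<Sum>x\<in>F. (norm (app (X n) x - f x))\<^sup>2) \<le> e\<^sup>2" if "n \<ge> N" "finite F" for n F
    proof (rule LIMSEQ_le_const2)
      show "(\<lambda>m. \<Sum>x\<in>F. (norm (app (X n) x - app (X m) x))\<^sup>2) \<longlonglongrightarrow> (\<Sum>x\<in>F. (norm (app (X n) x - f x))\<^sup>2)"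
        by (intro tendsto_intros f)
      have "(\<Sum>x\<in>F. (norm (app (X n) x - app (X m) x))\<^sup>2) \<le> e\<^sup>2" if "m \<ge> N" for m
      proof -
        have "(\<Sum>x\<in>F. (norm (app (X n) x - app (X m) x))\<^sup>2) \<le> (norm (X n - X m))\<^sup>2"
          using sum_norm_app_le[OF \<open>finite F\<close>, of "X n - X m"] by simp
        also have "\<dots> \<le> e\<^sup>2" using N[OF \<open>n \<ge> N\<close> that] by (intro power_mono) (auto simp: dist_norm)
        finally show ?thesis .
      qed
      then show "\<exists>M. \<forall>m\<ge>M. (\<Sum>x\<in>F. (norm (app (X n) x - app (X m) x))\<^sup>2) \<le> e\<^sup>2" by blast
    qed
    then show ?thesis by blast
  qed
  obtain N where "\<And>F. finite F \<Longrightarrow> (\<Sum>x\<in>F. (norm (app (X N) x - f x))\<^sup>2) \<le> 1\<^sup>2"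
    using close[of 1] by auto
  then have "(\<lambda>x. (norm (app (X N) x - f x))\<^sup>2) summable_on UNIV"
    by (intro nonneg_bdd_above_summable_on) (auto intro!: bdd_aboveI[of _ 1])
  then have "(\<lambda>x. app (X N) x - f x) \<in> l2" by (simp add: l2_def)
  from l2_add[OF app l2_scaleR[OF this, of "- 1"], of "X N"] have "f \<in> l2"
    by (simp add: scaleR_minus_left)
  define L where "L = Abs_ell2 f"
  have L: "app L = f" using \<open>f \<in> l2\<close> by (simp add: L_def Abs_ell2_inverse)
  have "X \<longlonglongrightarrow> L"
  proof (rule LIMSEQ_I)
    fix e :: real assume e: "e > 0"
    then obtain N where N: "\<And>n F. n \<ge> N \<Longrightarrow> finite F \<Longrightarrow> (\<Sum>x\<in>F. (norm (app (X n) x - f x))\<^sup>2) \<le> (e/2)\<^sup>2"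
      using close[of "e/2"] by auto
    have "norm (X n - L) < e" if "n \<ge> N" for n
    proof -
      have "norm (X n - L) \<le> e / 2"
        by (rule norm_le_if_finite_sums_le) (use N[OF that] e in \<open>auto simp: L\<close>)
      then show ?thesis using e by simp
    qed
    then show "\<exists>N. \<forall>n\<ge>N. norm (X n - L) < e" by blast
  qed
  then show "convergent X" by (auto simp: convergent_def)
qed

definition sc :: "complex \<Rightarrow> ell2 \<Rightarrow> ell2" where
  "sc z \<psi> = Abs_ell2 (\<lambda>x. csmult z (app \<psi> x))"

lemma app_sc [simp]: "app (sc z \<psi>) x = csmult z (app \<psi> x)"
  by (simp add: sc_def Abs_ell2_inverse l2_csmult app)

interpretation ell2: complex_scaling sc
proof
  fix r :: real and z w \<psi> \<phi>
  show "sc (complex_of_real r) \<psi> = r *\<^sub>R \<psi>"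
    by (rule ell2_eqI) (simp add: csmult_def prod_eq_iff scaleR_conv_of_real)
  show "sc z (sc w \<psi>) = sc (z * w) \<psi>"
    by (rule ell2_eqI) (simp add: csmult_def)
  show "sc (z + w) \<psi> = sc z \<psi> + sc w \<psi>"
    by (rule ell2_eqI) (simp add: csmult_def distrib_right)
  show "sc z (\<psi> + \<phi>) = sc z \<psi> + sc z \<phi>"
    by (rule ell2_eqI) (simp add: csmult_def distrib_left)
  show "inner (sc z \<psi>) \<phi> = inner \<psi> (sc (cnj z) \<phi>)"
    unfolding inner_ell2_def
    by (rule infsum_cong) (simp add: csmult_def inner_prod_def inner_complex_def algebra_simps)
qed

definition cut :: "int set \<Rightarrow> ell2 \<Rightarrow> ell2" where
  "cut S \<psi> = Abs_ell2 (\<lambda>x. if x \<in> S then app \<psi> x else 0)"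

lemma app_cut [simp]: "app (cut S \<psi>) x = (if x \<in> S then app \<psi> x else 0)"
proof -
  have "(\<lambda>x. if x \<in> S then app \<psi> x else 0) \<in> l2"
    by (rule l2_dominated[OF app[of \<psi>], of _ 1]) auto
  then show ?thesis by (simp add: cut_def Abs_ell2_inverse)
qed

lemma norm_cut_le: "norm (cut S \<psi>) \<le> norm \<psi>"
  using norm_ell2_dominated[of "cut S \<psi>" 1 \<psi>] by auto

lemma norm_finite_support:
  assumes "finite S" "\<And>x. x \<notin> S \<Longrightarrow> app \<psi> x = 0"
  shows "(norm \<psi>)\<^sup>2 = (\<Sum>x\<in>S. (norm (app \<psi> x))\<^sup>2)"
proof -
  have "(norm \<psi>)\<^sup>2 = (\<Sum>\<^sub>\<infinity>x\<in>S. (norm (app \<psi> x))\<^sup>2)"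
    unfolding norm_ell2_sq by (rule infsum_cong_neutral) (use assms in auto)
  then show ?thesis using assms by simp
qed

section \<open>The walk operator\<close>

text \<open>For raw functions this combines square summability with the value of the squared norm,
  so one statement about \<open>Gam\<close> yields both that it maps into \<open>l2\<close> and that
  it is isometric.\<close>

definition sq_sum :: "state \<Rightarrow> real \<Rightarrow> bool" where
  "sq_sum \<psi> s \<longleftrightarrow> ((\<lambda>x. (norm (\<psi> x))\<^sup>2) has_sum s) UNIV"

lemma sq_sum_app: "sq_sum (app \<psi>) ((norm \<psi>)\<^sup>2)"
  unfolding sq_sum_def by (rule has_sum_norm_ell2)

lemma sq_sum_imp_l2: "sq_sum \<psi> s \<Longrightarrow> \<psi> \<in> l2"
  by (auto simp: sq_sum_def l2_def summable_on_def)

lemma norm_eq_if_sq_sum: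
  assumes "sq_sum (app \<psi>) ((norm (\<phi>::ell2))\<^sup>2)"
  shows "norm \<psi> = norm \<phi>"
proof -
  have "(norm \<psi>)\<^sup>2 = (norm \<phi>)\<^sup>2"
    using sq_sum_app[of \<psi>] assms unfolding sq_sum_def by (rule has_sum_unique)
  then show ?thesis by simp
qed

lemma norm_prod_sq: "(norm v)\<^sup>2 = (norm (fst v))\<^sup>2 + (norm (snd v))\<^sup>2"
  by (simp add: norm_prod_def)

lemma has_sum_translate:
  fixes f :: "int \<Rightarrow> real"
  shows "((\<lambda>x. f (x + k)) has_sum s) UNIV \<longleftrightarrow> (f has_sum s) UNIV"
  by (rule has_sum_reindex_bij_betw) (rule bij_plus_right)

text \<open>\<open>Gam\<close> couples the upper component at x with the lower one at x + 1. After
  \<open>twist 1\<close> this coupling becomes sitewise, and \<open>Gam\<close> acts at each site by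
  the unitary matrix with rows (p, q) and (cnj q, -p).\<close>

definition twist :: "int \<Rightarrow> state \<Rightarrow> state" where
  "twist k \<psi> = (\<lambda>x. (fst (\<psi> x), snd (\<psi> (x + k))))"

lemma sq_sum_twist:
  assumes "sq_sum \<psi> s"
  shows "sq_sum (twist k \<psi>) s"
proof -
  have s: "(\<lambda>x. (norm (\<psi> x))\<^sup>2) summable_on UNIV"
    using assms by (auto simp: sq_sum_def summable_on_def)
  have 1: "(\<lambda>x. (norm (fst (\<psi> x)))\<^sup>2) summable_on UNIV" and 2: "(\<lambda>x. (norm (snd (\<psi> x)))\<^sup>2) summable_on UNIV"
    by (rule summable_on_comparison_test[OF s]; simp add: norm_prod_sq)+
  then obtain a b where a: "((\<lambda>x. (norm (fst (\<psi> x)))\<^sup>2) has_sum a) UNIV"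
    and b: "((\<lambda>x. (norm (snd (\<psi> x)))\<^sup>2) has_sum b) UNIV"
    by (auto simp: summable_on_def)
  have "((\<lambda>x. (norm (\<psi> x))\<^sup>2) has_sum (a + b)) UNIV"
    unfolding norm_prod_sq by (rule has_sum_add[OF a b])
  then have "s = a + b" using assms unfolding sq_sum_def by (metis has_sum_unique)
  moreover have "((\<lambda>x. (norm (snd (\<psi> (x + k))))\<^sup>2) has_sum b) UNIV"
    using b by (subst has_sum_translate[where f = "\<lambda>x. (norm (snd (\<psi> x)))\<^sup>2"])
  ultimately show ?thesis
    using has_sum_add[OF a] unfolding sq_sum_def norm_prod_sq twist_def by simp
qed

lemma sq_sum_twist_iff: "sq_sum (twist k \<psi>) s \<longleftrightarrow> sq_sum \<psi> s"
proof
  assume "sq_sum (twist k \<psi>) s"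
  then have "sq_sum (twist (- k) (twist k \<psi>)) s" by (rule sq_sum_twist)
  then show "sq_sum \<psi> s" by (simp add: twist_def)
qed (rule sq_sum_twist)

lemma sq_sum_Gam:
  assumes "p\<^sup>2 + (norm q)\<^sup>2 = 1" "sq_sum \<psi> s"
  shows "sq_sum (Gam p q \<psi>) s"
proof -
  have eq: "(norm (twist 1 (Gam p q \<psi>) x))\<^sup>2 = (norm (twist 1 \<psi> x))\<^sup>2" for x
  proof -
    define u v where "u = fst (\<psi> x)" and "v = snd (\<psi> (x + 1))"
    have "(norm (of_real p * u + q * v))\<^sup>2 + (norm (cnj q * u - of_real p * v))\<^sup>2
        = (p\<^sup>2 + (norm q)\<^sup>2) * ((norm u)\<^sup>2 + (norm v)\<^sup>2)"
      unfolding cmod_power2 by (simp add: power2_eq_square algebra_simps)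
    then show ?thesis
      using assms(1) by (simp add: norm_prod_sq twist_def Gam_def u_def v_def)
  qed
  have "sq_sum (twist 1 (Gam p q \<psi>)) s"
    using sq_sum_twist[OF assms(2), of 1] unfolding sq_sum_def eq .
  then show ?thesis by (simp add: sq_sum_twist_iff)
qed

definition Gop :: "real \<Rightarrow> complex \<Rightarrow> ell2 \<Rightarrow> ell2" where
  "Gop p q \<psi> = Abs_ell2 (Gam p q (app \<psi>))"

definition Cop :: "(int \<Rightarrow> real) \<Rightarrow> (int \<Rightarrow> real) \<Rightarrow> (int \<Rightarrow> complex) \<Rightarrow> ell2 \<Rightarrow> ell2" where
  "Cop a1 a2 b \<psi> = Abs_ell2 (Coin a1 a2 b (app \<psi>))"

definition translate :: "int \<Rightarrow> ell2 \<Rightarrow> ell2" where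
  "translate k \<psi> = Abs_ell2 (\<lambda>x. app \<psi> (x + k))"

lemma sq_sum_translate: "sq_sum (\<lambda>x. app \<psi> (x + k)) ((norm \<psi>)\<^sup>2)"
  unfolding sq_sum_def has_sum_translate[of "\<lambda>x. (norm (app \<psi> x))\<^sup>2"] by (rule has_sum_norm_ell2)

lemma app_translate [simp]: "app (translate k \<psi>) x = app \<psi> (x + k)"
  unfolding translate_def by (simp add: Abs_ell2_inverse sq_sum_imp_l2[OF sq_sum_translate])

lemma norm_translate [simp]: "norm (translate k \<psi>) = norm \<psi>"
  by (rule norm_eq_if_sq_sum) (use sq_sum_translate[of \<psi> k] in \<open>simp add: sq_sum_def\<close>)

lemma app_Gop:
  assumes "p\<^sup>2 + (norm q)\<^sup>2 = 1"
  shows "app (Gop p q \<psi>) = Gam p q (app \<psi>)"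
  unfolding Gop_def
  by (rule Abs_ell2_inverse) (rule sq_sum_imp_l2[OF sq_sum_Gam[OF assms sq_sum_app]])

lemma norm_Gop:
  assumes "p\<^sup>2 + (norm q)\<^sup>2 = 1"
  shows "norm (Gop p q \<psi>) = norm \<psi>"
  by (rule norm_eq_if_sq_sum) (simp add: app_Gop[OF assms] sq_sum_Gam[OF assms sq_sum_app])

lemma Gop_diff:
  assumes "p\<^sup>2 + (norm q)\<^sup>2 = 1"
  shows "Gop p q (\<psi> - \<phi>) = Gop p q \<psi> - Gop p q \<phi>"
  by (rule ell2_eqI) (simp add: app_Gop[OF assms] Gam_def algebra_simps)

section \<open>The walk as a unitary operator, and transport of spectrum and eigenspaces\<close>

locale walk =
  fixes p :: real and q :: complex and a1 a2 :: "int \<Rightarrow> real" and b :: "int \<Rightarrow> complex"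
  assumes pq: "p\<^sup>2 + (norm q)\<^sup>2 = 1"
    and coin1: "(a1 x)\<^sup>2 + (norm (b x))\<^sup>2 = 1"
    and coin2: "(a2 x)\<^sup>2 + (norm (b x))\<^sup>2 = 1"
    and coin3: "b x * complex_of_real (a1 x + a2 x) = 0"
begin

definition step :: "ell2 \<Rightarrow> ell2" where
  "step \<psi> = Gop p q (Cop a1 a2 b \<psi>)"

text \<open>Shift and coin are both involutions, so reversing their order inverts
  \<open>step\<close>.\<close>

definition step_inv :: "ell2 \<Rightarrow> ell2" where
  "step_inv \<psi> = Cop a1 a2 b (Gop p q \<psi>)"

lemma b_zero_or: "b x = 0 \<or> a2 x = - a1 x"
  using coin3[of x] by (metis add.inverse_unique mult_eq_0_iff of_real_eq_0_iff)

lemma norm_Coin: "norm (Coin a1 a2 b \<psi> x) = norm (\<psi> x)"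
proof (rule power2_eq_imp_eq)
  define u v where "u = fst (\<psi> x)" and "v = snd (\<psi> x)"
  have "(norm (of_real (a1 x) * u + cnj (b x) * v))\<^sup>2 + (norm (b x * u + of_real (a2 x) * v))\<^sup>2
      = ((a1 x)\<^sup>2 + (norm (b x))\<^sup>2) * (norm u)\<^sup>2 + ((a2 x)\<^sup>2 + (norm (b x))\<^sup>2) * (norm v)\<^sup>2
        + 2 * Re (u * cnj v * (b x * of_real (a1 x + a2 x)))"
    unfolding cmod_power2 by (simp add: power2_eq_square algebra_simps)
  then show "(norm (Coin a1 a2 b \<psi> x))\<^sup>2 = (norm (\<psi> x))\<^sup>2"
    unfolding coin1 coin2 coin3 by (simp add: norm_prod_sq Coin_def u_def v_def)
qed auto

lemma Coin_Coin: "Coin a1 a2 b (Coin a1 a2 b \<psi>) = \<psi>"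
proof
  fix x
  have 1: "of_real (a1 x) * of_real (a1 x) + cnj (b x) * b x = 1"
    and 2: "of_real (a2 x) * of_real (a2 x) + cnj (b x) * b x = 1"
    using arg_cong[OF coin1, of complex_of_real x] arg_cong[OF coin2, of complex_of_real x]
    unfolding of_real_add complex_norm_square by (simp_all add: power2_eq_square mult.commute)
  have 3: "b x * of_real (a1 x) + of_real (a2 x) * b x = 0"
    using coin3[of x] by (simp add: algebra_simps)
  have 4: "of_real (a1 x) * cnj (b x) + cnj (b x) * of_real (a2 x) = 0"
    using arg_cong[OF 3, of cnj] by (simp add: algebra_simps)
  have "of_real (a1 x) * (of_real (a1 x) * u + cnj (b x) * v) + cnj (b x) * (b x * u + of_real (a2 x) * v)
     = (of_real (a1 x) * of_real (a1 x) + cnj (b x) * b x) * u + (of_real (a1 x) * cnj (b x) + cnj (b x) * of_real (a2 x)) * v"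
    "b x * (of_real (a1 x) * u + cnj (b x) * v) + of_real (a2 x) * (b x * u + of_real (a2 x) * v)
     = (b x * of_real (a1 x) + of_real (a2 x) * b x) * u + (of_real (a2 x) * of_real (a2 x) + cnj (b x) * b x) * v" for u v
    by (simp_all add: algebra_simps)
  then show "Coin a1 a2 b (Coin a1 a2 b \<psi>) x = \<psi> x"
    by (simp add: Coin_def 1 2 3 4)
qed

lemma Gam_Gam: "Gam p q (Gam p q \<psi>) = \<psi>"
proof
  fix x
  have 1: "of_real p * of_real p + q * cnj q = (1::complex)"
    using arg_cong[OF pq, of complex_of_real] unfolding of_real_add complex_norm_square
    by (simp add: power2_eq_square)
  have "of_real p * (of_real p * u + q * v) + q * (cnj q * u - of_real p * v) = (of_real p * of_real p + q * cnj q) * u"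
    "cnj q * (of_real p * u + q * v) - of_real p * (cnj q * u - of_real p * v) = (of_real p * of_real p + q * cnj q) * v"
    for u v by (simp_all add: algebra_simps)
  then show "Gam p q (Gam p q \<psi>) x = \<psi> x" by (simp add: Gam_def 1)
qed

lemma app_Cop: "app (Cop a1 a2 b \<psi>) = Coin a1 a2 b (app \<psi>)"
  unfolding Cop_def
  by (rule Abs_ell2_inverse, rule l2_dominated[OF app[of \<psi>], of _ 1]) (simp add: norm_Coin)

lemma norm_Cop: "norm (Cop a1 a2 b \<psi>) = norm \<psi>"
proof -
  have "sq_sum (app (Cop a1 a2 b \<psi>)) ((norm \<psi>)\<^sup>2)"
    using sq_sum_app[of \<psi>] by (simp add: sq_sum_def app_Cop norm_Coin)
  then show ?thesis by (rule norm_eq_if_sq_sum)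
qed

lemma app_step: "app (step \<psi>) = Gam p q (Coin a1 a2 b (app \<psi>))"
  by (simp add: step_def app_Gop[OF pq] app_Cop)

lemma app_step_inv: "app (step_inv \<psi>) = Coin a1 a2 b (Gam p q (app \<psi>))"
  by (simp add: step_inv_def app_Gop[OF pq] app_Cop)

sublocale unitary_operator sc step step_inv
proof
  fix \<psi> \<phi> z
  show "step (\<psi> + \<phi>) = step \<psi> + step \<phi>"
    by (rule ell2_eqI) (simp add: app_step Gam_def Coin_def, simp add: algebra_simps)
  show "step (sc z \<psi>) = sc z (step \<psi>)"
    by (rule ell2_eqI) (simp add: app_step Gam_def Coin_def csmult_def, simp add: algebra_simps)
  show "norm (step \<psi>) = norm \<psi>" by (simp add: step_def norm_Gop[OF pq] norm_Cop)
  show "step (step_inv \<psi>) = \<psi>" "step_inv (step \<psi>) = \<psi>"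
    by (rule ell2_eqI, simp add: app_step app_step_inv Gam_Gam Coin_Coin)+
qed

lemma app_T: "app (T z \<psi>) x = Gam p q (Coin a1 a2 b (app \<psi>)) x - csmult z (app \<psi> x)"
  by (simp add: T_def app_step)

text \<open>Finite propagation. It allows a state to be cut where it vanishes on neighbouring sites,
  and confines the error of a truncated plane wave to the ends of the block.\<close>

lemma app_T_local:
  assumes "app \<psi> (x - 1) = app \<phi> (x - 1)" "app \<psi> x = app \<phi> x" "app \<psi> (x + 1) = app \<phi> (x + 1)"
  shows "app (T z \<psi>) x = app (T z \<phi>) x"
  using assms by (simp add: app_T Gam_def Coin_def)

lemma spec_iff: "z \<in> spec (Gam p q \<circ> Coin a1 a2 b) \<longleftrightarrow> \<not> bij (T z)"
proof -
  let ?f = "\<lambda>\<psi> x. (Gam p q \<circ> Coin a1 a2 b) \<psi> x - csmult z (\<psi> x)"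
  have app: "bij_betw app UNIV l2"
    by (simp add: bij_betw_def inj_on_def app_inject type_definition.Rep_range[OF type_definition_ell2])
  have comm: "?f \<circ> app = app \<circ> T z" by (auto simp: fun_eq_iff app_T)
  have "bij_betw ?f l2 l2 \<longleftrightarrow> bij_betw (?f \<circ> app) UNIV l2" by (rule bij_betw_comp_iff[OF app])
  also have "\<dots> \<longleftrightarrow> bij (T z)" unfolding comm by (rule bij_betw_comp_iff2[OF app, symmetric]) simp
  finally show ?thesis by (simp add: spec_def)
qed

lemma eigenspace_eq: "eigenspace (Gam p q \<circ> Coin a1 a2 b) z = app ` {\<psi>. T z \<psi> = 0}"
proof -
  have "T z \<psi> = 0 \<longleftrightarrow> Gam p q (Coin a1 a2 b (app \<psi>)) = (\<lambda>x. csmult z (app \<psi> x))" for \<psi>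
  proof -
    have "T z \<psi> = 0 \<longleftrightarrow> app (T z \<psi>) = app 0" by (simp only: app_inject)
    then show ?thesis by (simp add: fun_eq_iff app_T)
  qed
  moreover have "l2 = range app" by (simp add: type_definition.Rep_range[OF type_definition_ell2])
  ultimately show ?thesis unfolding eigenspace_def by auto
qed

text \<open>The shift is isometric, so only the sitewise difference of the coins matters. Closeness
  is demanded only on the support of the state; hence a constant coin can replace the true one far
  out.\<close>

lemma norm_step_diff_le:
  assumes w: "walk p q a1' a2' b'" and d: "d \<ge> 0"
    and le: "\<And>x. app \<psi> x \<noteq> 0 \<Longrightarrow> \<bar>a1 x - a1' x\<bar> + \<bar>a2 x - a2' x\<bar> + 2 * cmod (b x - b' x) \<le> d"
  shows "norm (step \<psi> - walk.step p q a1' a2' b' \<psi>) \<le> d * norm \<psi>"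
proof -
  interpret w: walk p q a1' a2' b' by (rule w)
  have "step \<psi> - w.step \<psi> = Gop p q (Cop a1 a2 b \<psi> - Cop a1' a2' b' \<psi>)"
    by (simp add: step_def w.step_def Gop_diff[OF pq])
  then have "norm (step \<psi> - w.step \<psi>) = norm (Cop a1 a2 b \<psi> - Cop a1' a2' b' \<psi>)"
    by (simp add: norm_Gop[OF pq])
  also have "\<dots> \<le> d * norm \<psi>"
  proof (rule norm_ell2_dominated[OF _ d])
    fix x
    define u v where "u = fst (app \<psi> x)" and "v = snd (app \<psi> x)"
    have uv: "cmod u \<le> norm (app \<psi> x)" "cmod v \<le> norm (app \<psi> x)"
      unfolding u_def v_def by (metis norm_fst_le norm_snd_le prod.collapse)+
    show "norm (app (Cop a1 a2 b \<psi> - Cop a1' a2' b' \<psi>) x) \<le> d * norm (app \<psi> x)"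
    proof (cases "app \<psi> x = 0")
      case True
      then show ?thesis by (simp add: app_Cop w.app_Cop Coin_def)
    next
      case False
      have "app (Cop a1 a2 b \<psi> - Cop a1' a2' b' \<psi>) x
          = (of_real (a1 x - a1' x) * u + cnj (b x - b' x) * v, (b x - b' x) * u + of_real (a2 x - a2' x) * v)"
        by (simp add: app_Cop w.app_Cop Coin_def u_def v_def algebra_simps)
      also have "norm \<dots> \<le> norm (of_real (a1 x - a1' x) * u + cnj (b x - b' x) * v)
          + norm ((b x - b' x) * u + of_real (a2 x - a2' x) * v)"
        by (rule norm_Pair_le)
      also have "\<dots> \<le> (\<bar>a1 x - a1' x\<bar> * cmod u + cmod (b x - b' x) * cmod v)
          + (cmod (b x - b' x) * cmod u + \<bar>a2 x - a2' x\<bar> * cmod v)"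
        by (intro add_mono order_trans[OF norm_triangle_ineq])
          (simp_all only: norm_mult norm_of_real complex_mod_cnj order_refl)
      also have "\<dots> \<le> (\<bar>a1 x - a1' x\<bar> * norm (app \<psi> x) + cmod (b x - b' x) * norm (app \<psi> x))
          + (cmod (b x - b' x) * norm (app \<psi> x) + \<bar>a2 x - a2' x\<bar> * norm (app \<psi> x))"
        by (intro add_mono mult_left_mono uv) auto
      also have "\<dots> = (\<bar>a1 x - a1' x\<bar> + \<bar>a2 x - a2' x\<bar> + 2 * cmod (b x - b' x)) * norm (app \<psi> x)"
        by (simp add: algebra_simps)
      also have "\<dots> \<le> d * norm (app \<psi> x)" by (intro mult_right_mono le False) simp
      finally show ?thesis .
    qed
  qed
  finally show ?thesis .
qed

end

section \<open>Approximate eigenvectors escaping to infinity\<close>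

text \<open>Turns the explicit combinations in \<open>fin_dim\<close> into spans, so that dimension
  counting by independent sets becomes available.\<close>

global_interpretation state: vector_space "\<lambda>c (\<psi>::state) x. csmult c (\<psi> x)"
  by standard (auto simp: csmult_def algebra_simps fun_eq_iff)

lemma sum_state_apply: "(\<Sum>i\<in>A. f i) x = (\<Sum>i\<in>A. (f i :: state) x)"
  by (induction A rule: infinite_finite_induct) auto

lemma app_sum: "app (\<Sum>i\<in>A. f i) x = (\<Sum>i\<in>A. app (f i) x)"
  by (induction A rule: infinite_finite_induct) auto

lemma fin_dim_iff_span: "fin_dim E \<longleftrightarrow> (\<exists>F. finite F \<and> E \<subseteq> state.span F)"
proof -
  have sum: "(\<lambda>x. \<Sum>\<phi>\<in>F. csmult (c \<phi>) (\<phi> x)) = (\<Sum>\<phi>\<in>F. (\<lambda>x. csmult (c \<phi>) (\<phi> x)))" for F :: "state set" and c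
    by (rule ext) (subst sum_state_apply, rule refl)
  show ?thesis unfolding fin_dim_def sum
    by (rule ex_cong1, rule conj_cong) (auto simp: state.span_finite)
qed

text \<open>Each functional costs at most one dimension: if \<open>f e\<close> is nonzero,
  subtracting \<open>f \<psi> / f e\<close> times \<open>e\<close> moves any element of
  \<open>E\<close> into the kernel of \<open>f\<close>, which the induction hypothesis
  covers.\<close>

lemma fin_dim_if_coordinates_injective:
  assumes "finite S" "\<And>\<psi> \<phi> c. \<psi> \<in> E \<Longrightarrow> \<phi> \<in> E \<Longrightarrow> (\<lambda>x. \<psi> x - csmult c (\<phi> x)) \<in> E"
    "\<And>\<psi>. \<psi> \<in> E \<Longrightarrow> \<forall>f\<in>S. f \<psi> = 0 \<Longrightarrow> \<psi> = (\<lambda>_. 0)"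
    "\<And>f \<psi> \<phi> c. f \<in> S \<Longrightarrow> f (\<lambda>x. \<psi> x - csmult c (\<phi> x)) = f \<psi> - c * f \<phi>"
  shows "fin_dim E"
  using assms
proof (induction S arbitrary: E rule: finite_induct)
  case empty
  then show ?case by (auto simp: fin_dim_def intro!: exI[of _ "{}"])
next
  case (insert f S)
  define E' where "E' = {\<psi> \<in> E. f \<psi> = 0}"
  have f: "f (\<lambda>x. \<psi> x - csmult c (\<phi> x)) = f \<psi> - c * f \<phi>" for \<psi> \<phi> c
    by (rule insert.prems(3)) simp
  have "fin_dim E'"
  proof (rule insert.IH)
    fix \<psi> \<phi> c assume "\<psi> \<in> E'" "\<phi> \<in> E'"
    then show "(\<lambda>x. \<psi> x - csmult c (\<phi> x)) \<in> E'"
      unfolding E'_def using f[of \<psi> c \<phi>] insert.prems(1)[of \<psi> \<phi> c] by simp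
  next
    fix \<psi> assume "\<psi> \<in> E'" "\<forall>f\<in>S. f \<psi> = 0"
    then show "\<psi> = (\<lambda>_. 0)" unfolding E'_def by (intro insert.prems(2)) auto
  qed (rule insert.prems(3), simp)
  then obtain F where F: "finite F" "E' \<subseteq> state.span F" unfolding fin_dim_iff_span by blast
  show ?case
  proof (cases "\<exists>e\<in>E. f e \<noteq> 0")
    case False
    then have "E = E'" by (auto simp: E'_def)
    then show ?thesis using \<open>fin_dim E'\<close> by simp
  next
    case True
    then obtain e where e: "e \<in> E" "f e \<noteq> 0" by blast
    have "\<psi> \<in> state.span (insert e F)" if "\<psi> \<in> E" for \<psi>
    proof -
      define c where "c = f \<psi> / f e"
      have "(\<lambda>x. \<psi> x - csmult c (e x)) \<in> E'"
        unfolding E'_def using f[of \<psi> c e] insert.prems(1)[OF that e(1), of c] e(2) by (simp add: c_def)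
      then have "\<psi> - (\<lambda>x. csmult c (e x)) \<in> state.span F" using F unfolding fun_diff_def by auto
      then show ?thesis unfolding state.span_insert by blast
    qed
    then show ?thesis using F(1) unfolding fin_dim_iff_span by (intro exI[of _ "insert e F"]) auto
  qed
qed

context walk
begin

text \<open>A singular Weyl sequence in choice-ready form. The outer radius \<open>M\<close> is
  recorded so that the next state can be taken beyond it, with disjoint support.\<close>

definition far_approx :: "complex \<Rightarrow> bool" where
  "far_approx z \<longleftrightarrow> (\<forall>N. \<forall>e>0. \<exists>M \<psi>. norm \<psi> = 1 \<and> (\<forall>x. app \<psi> x \<noteq> 0 \<longrightarrow> N < \<bar>x\<bar> \<and> \<bar>x\<bar> \<le> M)
    \<and> norm (T z \<psi>) < e)"

lemma far_approx_imp_not_bij: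
  assumes "far_approx z"
  shows "\<not> bij (T z)"
proof
  assume "bij (T z)"
  then obtain c where c: "c > 0" "\<And>\<psi>. c * norm \<psi> \<le> norm (T z \<psi>)"
    by (auto simp: bij_iff_bounded_below bounded_below_at_def)
  obtain \<psi> where "norm \<psi> = 1" "norm (T z \<psi>) < c"
    using assms c(1) unfolding far_approx_def by meson
  then show False using c(2)[of \<psi>] by simp
qed

text \<open>Let \<open>c j\<close> have the largest modulus M. Restricting the combination of the
  \<psi>'s to the annulus of index j leaves only its j-th term, so that combination has norm at
  least M. As the \<phi>'s combine to 0, it equals the sum of \<open>c i\<close> times
  \<open>\<psi> i - \<phi> i\<close>, of norm at most m * M / (2 m) = M / 2. Hence M = 0.\<close>

lemma nearly_orthonormal_independent:
  fixes N :: "nat \<Rightarrow> int" and m :: nat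
  assumes \<psi>: "\<And>k. norm (\<psi> k) = 1" "\<And>k x. app (\<psi> k) x \<noteq> 0 \<Longrightarrow> N k < \<bar>x\<bar> \<and> \<bar>x\<bar> \<le> N (Suc k)"
    and N: "mono N" and close: "\<And>k. 2 * real m * norm (\<psi> k - \<phi> k) \<le> 1"
    and 0: "(\<Sum>k<m. sc (c k) (\<phi> k)) = 0" and k: "k < m"
  shows "c k = 0"
proof -
  define M where "M = Max ((\<lambda>k. cmod (c k)) ` {..<m})"
  have M: "M \<in> (\<lambda>k. cmod (c k)) ` {..<m}" unfolding M_def using k by (intro Max_in) auto
  have le: "cmod (c i) \<le> M" if "i < m" for i unfolding M_def using that by (intro Max_ge) auto
  obtain j where j: "j < m" "M = cmod (c j)" using M by auto
  define S where "S = {x. N j < \<bar>x\<bar> \<and> \<bar>x\<bar> \<le> N (Suc j)}"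
  have "app (\<psi> i) x = 0" if "i \<noteq> j" "x \<in> S" for i x
  proof (rule ccontr)
    assume "app (\<psi> i) x \<noteq> 0"
    then have "N i < \<bar>x\<bar>" "\<bar>x\<bar> \<le> N (Suc i)" "N j < \<bar>x\<bar>" "\<bar>x\<bar> \<le> N (Suc j)" using \<psi>(2) that by (auto simp: S_def)
    moreover have "Suc i \<le> j \<or> Suc j \<le> i" using that by auto
    then have "N (Suc i) \<le> N j \<or> N (Suc j) \<le> N i" using N by (auto simp: mono_def)
    ultimately show False by linarith
  qed
  then have "app (cut S (\<Sum>i<m. sc (c i) (\<psi> i))) x = app (sc (c j) (\<psi> j)) x" for x
  proof (cases "x \<in> S")
    case True
    then have "app (cut S (\<Sum>i<m. sc (c i) (\<psi> i))) x = (\<Sum>i<m. csmult (c i) (app (\<psi> i) x))"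
      by (simp add: app_sum)
    also have "\<dots> = (\<Sum>i\<in>{j}. csmult (c i) (app (\<psi> i) x))"
      by (rule sum.mono_neutral_right) (use j True \<open>\<And>i x. i \<noteq> j \<Longrightarrow> x \<in> S \<Longrightarrow> app (\<psi> i) x = 0\<close> in \<open>auto simp: csmult_def zero_prod_def\<close>)
    finally show ?thesis by simp
  next
    case False
    then have "app (\<psi> j) x = 0" using \<psi>(2)[of j x] by (auto simp: S_def)
    then show ?thesis using False by (simp add: csmult_def zero_prod_def)
  qed
  then have "cut S (\<Sum>i<m. sc (c i) (\<psi> i)) = sc (c j) (\<psi> j)" by (rule ell2_eqI)
  then have "M \<le> norm (\<Sum>i<m. sc (c i) (\<psi> i))"
    using norm_cut_le[of S "\<Sum>i<m. sc (c i) (\<psi> i)"] \<psi>(1)[of j] by (simp add: j)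
  also have "(\<Sum>i<m. sc (c i) (\<psi> i)) = (\<Sum>i<m. sc (c i) (\<psi> i - \<phi> i))"
    using 0 by (simp add: ell2.sc_diff_right sum_subtractf)
  also have "norm \<dots> \<le> (\<Sum>i<m. M * (1 / (2 * real m)))"
  proof (rule sum_norm_le)
    fix i assume "i \<in> {..<m}"
    then show "norm (sc (c i) (\<psi> i - \<phi> i)) \<le> M * (1 / (2 * real m))"
      unfolding ell2.norm_sc using close[of i] le[of i] k
      by (intro mult_mono) (auto simp: field_simps intro: order_trans[OF norm_ge_zero])
  qed
  also have "\<dots> = M / 2" using k by simp
  finally have "M \<le> 0" by simp
  then show ?thesis using le[OF k] by (metis norm_le_zero_iff order_trans)
qed

lemma far_approx_imp_not_disc:
  assumes "far_approx z" "cmod z = 1"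
  shows "z \<notin> disc_spec (Gam p q \<circ> Coin a1 a2 b)"
proof
  let ?W = "Gam p q \<circ> Coin a1 a2 b"
  assume "z \<in> disc_spec ?W"
  then obtain e where e: "e > 0" "ball z e \<inter> spec ?W = {z}" and fd: "fin_dim (eigenspace ?W z)"
    unfolding disc_spec_def by blast
  have "bij (T w)" if "w \<noteq> z" "cmod (w - z) < e" for w
  proof (rule ccontr)
    assume "\<not> bij (T w)"
    then have "w \<in> ball z e \<inter> spec ?W" using that by (simp add: spec_iff dist_norm norm_minus_commute)
    then show False using e that by auto
  qed
  then obtain C where C: "\<And>x. \<exists>y. T z y = 0 \<and> norm (x - y) \<le> C * norm (T z x)"
    using isolated_imp_approximate_kernel[OF assms(2) e(1)] by blast
  obtain F where F: "finite F" "eigenspace ?W z \<subseteq> state.span F" using fd by (auto simp: fin_dim_iff_span)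
  \<comment> \<open>One vector more than a spanning set allows. The tolerance \<open>d\<close> makes
    C * d at most 1 / (2 m), as needed for independence; |C| + 1 is used because the sign of
    \<open>C\<close> is unknown.\<close>
  define m where "m = Suc (card F)"
  define d where "d = 1 / (2 * real m * (\<bar>C\<bar> + 1))"
  have m: "real m > 0" by (simp add: m_def)
  have d: "d > 0" unfolding d_def using m by (intro divide_pos_pos mult_pos_pos) auto
  have "\<forall>N. \<exists>M \<psi>. norm \<psi> = 1 \<and> (\<forall>x. app \<psi> x \<noteq> 0 \<longrightarrow> N < \<bar>x\<bar> \<and> \<bar>x\<bar> \<le> M) \<and> norm (T z \<psi>) < d"
    using assms(1) d unfolding far_approx_def by blast
  then obtain g h where "\<forall>N. norm (h N) = 1 \<and> (\<forall>x. app (h N) x \<noteq> 0 \<longrightarrow> N < \<bar>x\<bar> \<and> \<bar>x\<bar> \<le> g N) \<and> norm (T z (h N)) < d"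
    unfolding choice_iff by blast
  then have gh: "\<And>N. norm (h N) = 1" "\<And>N x. app (h N) x \<noteq> 0 \<Longrightarrow> N < \<bar>x\<bar> \<and> \<bar>x\<bar> \<le> g N"
    "\<And>N. norm (T z (h N)) < d"
    by blast+
  \<comment> \<open>\<open>g N\<close> bounds the support of the state chosen beyond radius
    \<open>N\<close>. Iterating \<open>g\<close> thus places the supports in successive
    annuli.\<close>
  define N where "N k = (g ^^ k) 0" for k
  define \<psi> where "\<psi> k = h (N k)" for k
  have NS: "N (Suc k) = g (N k)" for k by (simp add: N_def)
  have "N k \<le> N (Suc k)" for k
  proof (rule ccontr)
    assume "\<not> ?thesis"
    then have "app (h (N k)) x = app 0 x" for x using gh(2)[of "N k" x] by (cases "app (h (N k)) x = 0") (auto simp: NS)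
    then have "h (N k) = 0" by (rule ell2_eqI)
    then show False using gh(1)[of "N k"] by simp
  qed
  then have mono: "mono N" by (simp add: mono_iff_le_Suc)
  have "\<forall>k. \<exists>y. T z y = 0 \<and> norm (\<psi> k - y) \<le> C * norm (T z (\<psi> k))" using C by blast
  then obtain \<phi> where "\<forall>k. T z (\<phi> k) = 0 \<and> norm (\<psi> k - \<phi> k) \<le> C * norm (T z (\<psi> k))"
    unfolding choice_iff by blast
  then have \<phi>: "\<And>k. T z (\<phi> k) = 0" "\<And>k. norm (\<psi> k - \<phi> k) \<le> C * norm (T z (\<psi> k))" by blast+
  have close: "2 * real m * norm (\<psi> k - \<phi> k) \<le> 1" for k
  proof -
    have "norm (\<psi> k - \<phi> k) \<le> (\<bar>C\<bar> + 1) * d"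
      by (rule order_trans[OF \<phi>(2)], rule mult_mono) (use gh(3)[of "N k"] in \<open>auto simp: \<psi>_def\<close>)
    also have "\<dots> = 1 / (2 * real m)" by (simp add: d_def)
    finally show ?thesis using m by (simp add: field_simps)
  qed
  have indep: "c k = 0" if "(\<Sum>k<m. sc (c k) (\<phi> k)) = 0" "k < m" for c k
    by (rule nearly_orthonormal_independent[of \<psi> N m \<phi>, OF _ _ mono close that])
      (use gh in \<open>auto simp: \<psi>_def NS\<close>)
  have inj: "inj_on (\<lambda>k. app (\<phi> k)) {..<m}"
  proof (rule inj_onI, rule ccontr)
    fix i j assume ij: "i \<in> {..<m}" "j \<in> {..<m}" "app (\<phi> i) = app (\<phi> j)" "i \<noteq> j"
    \<comment> \<open>Independence below is a property of a set, so the vectors must first be shown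
      distinct: an equality would be a relation with coefficients 1 at \<open>i\<close> and -1 at
      \<open>j\<close>.\<close>
    define c :: "nat \<Rightarrow> complex" where "c k = (if k = i then 1 else 0) - (if k = j then 1 else 0)" for k
    have "(\<Sum>k<m. sc (c k) (\<phi> k)) = (\<Sum>k<m. (if k = i then \<phi> k else 0)) - (\<Sum>k<m. (if k = j then \<phi> k else 0))"
      unfolding sum_subtractf[symmetric] by (rule sum.cong) (auto simp: c_def ell2.sc_diff_left ell2.sc_minus_left)
    also have "\<dots> = 0" using ij by (simp add: app_inject)
    finally have "c i = 0" using indep ij by auto
    then show False using ij by (simp add: c_def)
  qed
  have "state.independent ((\<lambda>k. app (\<phi> k)) ` {..<m})"
  proof (rule state.independent_if_scalars_zero)
    fix f v
    assume s: "(\<Sum>v\<in>(\<lambda>k. app (\<phi> k)) ` {..<m}. (\<lambda>x. csmult (f v) (v x))) = 0"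
      and v: "v \<in> (\<lambda>k. app (\<phi> k)) ` {..<m}"
    then obtain k where k: "k < m" "v = app (\<phi> k)" by auto
    have "(\<Sum>k<m. (\<lambda>x. csmult (f (app (\<phi> k))) (app (\<phi> k) x))) = 0"
      using s by (simp add: sum.reindex[OF inj])
    then have "app (\<Sum>k<m. sc (f (app (\<phi> k))) (\<phi> k)) x = app 0 x" for x
      by (simp add: app_sum fun_eq_iff sum_state_apply)
    then have "(\<Sum>k<m. sc (f (app (\<phi> k))) (\<phi> k)) = 0" by (rule ell2_eqI)
    then show "f v = 0" using indep[of "\<lambda>k. f (app (\<phi> k))"] k by simp
  qed simp
  moreover have "(\<lambda>k. app (\<phi> k)) ` {..<m} \<subseteq> state.span F"
    using F(2) \<phi>(1) unfolding eigenspace_eq by auto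
  ultimately have "card ((\<lambda>k. app (\<phi> k)) ` {..<m}) \<le> card F"
    using state.independent_span_bound[OF F(1)] by blast
  then have "m \<le> card F" unfolding card_image[OF inj] by simp
  then show False by (simp add: m_def)
qed

end

section \<open>The discrete spectrum\<close>

lemma pointwise_convergent_subsequence:
  fixes f :: "nat \<Rightarrow> 'i \<Rightarrow> 'b::heine_borel"
  assumes "finite S" "\<And>x. bounded (range (\<lambda>n. f n x))"
  shows "\<exists>r :: nat \<Rightarrow> nat. strict_mono r \<and> (\<forall>x\<in>S. convergent (\<lambda>n. f (r n) x))"
  using assms(1)
proof (induction S rule: finite_induct)
  case empty
  then show ?case by (intro exI[of _ id]) (auto simp: strict_mono_def)
next
  case (insert y S)
  then obtain r :: "nat \<Rightarrow> nat" where r: "strict_mono r" "\<And>x. x \<in> S \<Longrightarrow> convergent (\<lambda>n. f (r n) x)"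
    by blast
  have "bounded (range (\<lambda>n. f (r n) y))"
    by (rule bounded_subset[OF assms(2)[of y]]) auto
  then obtain l s where s: "strict_mono (s :: nat \<Rightarrow> nat)" "((\<lambda>n. f (r n) y) \<circ> s) \<longlonglongrightarrow> l"
    using bounded_imp_convergent_subsequence[of "\<lambda>n. f (r n) y"] by blast
  have "convergent (\<lambda>n. f ((r \<circ> s) n) x)" if "x \<in> insert y S" for x
  proof (cases "x = y")
    case True
    then show ?thesis using s(2) by (auto simp: convergent_def o_def)
  next
    case False
    then have "convergent ((\<lambda>n. f (r n) x) \<circ> s)"
      using r(2)[of x] that s(1) by (intro convergent_subseq_convergent) auto
    then show ?thesis by (simp add: o_def)
  qed
  then show ?case using strict_mono_o[OF r(1) s(1)] by blast
qed

lemma cut_convergent: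
  assumes "finite S" "\<And>x. x \<in> S \<Longrightarrow> convergent (\<lambda>n. app (\<psi> n) x)"
  shows "convergent (\<lambda>n. cut S (\<psi> n))"
proof -
  define l where "l x = (if x \<in> S then lim (\<lambda>n. app (\<psi> n) x) else 0)" for x
  have l: "(\<lambda>n. app (\<psi> n) x) \<longlonglongrightarrow> l x" if "x \<in> S" for x
    using assms(2)[OF that] that by (simp add: l_def convergent_LIMSEQ_iff)
  have "(\<lambda>x. (norm (l x))\<^sup>2) summable_on UNIV"
    by (rule finite_nonzero_values_imp_summable_on, rule finite_subset[OF _ assms(1)]) (auto simp: l_def)
  then have "l \<in> l2" by (simp add: l2_def)
  then have L: "app (Abs_ell2 l) = l" by (simp add: Abs_ell2_inverse)
  have "(norm (cut S (\<psi> n) - Abs_ell2 l))\<^sup>2 = (\<Sum>x\<in>S. (norm (app (\<psi> n) x - l x))\<^sup>2)" for n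
    by (subst norm_finite_support[OF assms(1)]) (auto simp: L l_def)
  moreover have "(\<lambda>n. \<Sum>x\<in>S. (norm (app (\<psi> n) x - l x))\<^sup>2) \<longlonglongrightarrow> (\<Sum>x\<in>S. (norm (l x - l x))\<^sup>2)"
    by (intro tendsto_intros l)
  ultimately have "(\<lambda>n. (norm (cut S (\<psi> n) - Abs_ell2 l))\<^sup>2) \<longlonglongrightarrow> 0" by simp
  then have "(\<lambda>n. sqrt ((norm (cut S (\<psi> n) - Abs_ell2 l))\<^sup>2)) \<longlonglongrightarrow> sqrt 0" by (rule tendsto_real_sqrt)
  then have "(\<lambda>n. cut S (\<psi> n)) \<longlonglongrightarrow> Abs_ell2 l" by (simp add: tendsto_norm_zero_iff LIM_zero_iff)
  then show ?thesis by (auto simp: convergent_def)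
qed

context walk
begin

text \<open>A substitute for the Fredholm property at \<open>z\<close>: \<open>T z\<close> is
  bounded below, for c > 0, on a subspace of finite codimension.\<close>

definition off_box_bound :: "real \<Rightarrow> int \<Rightarrow> complex \<Rightarrow> bool" where
  "off_box_bound c N z \<longleftrightarrow> (\<forall>\<psi>. (\<forall>x. \<bar>x\<bar> \<le> N \<longrightarrow> app \<psi> x = 0) \<longrightarrow> c * norm \<psi> \<le> norm (T z \<psi>))"

lemma norm_le_box:
  assumes "off_box_bound c N z" "c > 0"
  shows "norm \<psi> \<le> (1 / c) * norm (T z \<psi>) + (1 + (1 + cmod z) / c) * norm (cut {-N..N} \<psi>)"
proof -
  let ?\<chi> = "cut {-N..N} \<psi>"
  have "app (\<psi> - ?\<chi>) x = 0" if "\<bar>x\<bar> \<le> N" for x using that by auto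
  then have "c * norm (\<psi> - ?\<chi>) \<le> norm (T z (\<psi> - ?\<chi>))"
    using assms(1) by (auto simp: off_box_bound_def)
  also have "\<dots> \<le> norm (T z \<psi>) + norm (T z ?\<chi>)" unfolding T_diff by (rule norm_triangle_ineq4)
  also have "\<dots> \<le> norm (T z \<psi>) + (1 + cmod z) * norm ?\<chi>" using norm_T_le by simp
  finally have "norm (\<psi> - ?\<chi>) \<le> (norm (T z \<psi>) + (1 + cmod z) * norm ?\<chi>) / c"
    using assms(2) by (simp add: field_simps)
  moreover have "norm \<psi> \<le> norm (\<psi> - ?\<chi>) + norm ?\<chi>"
    using norm_triangle_ineq[of "\<psi> - ?\<chi>" ?\<chi>] by simp
  ultimately show ?thesis by (simp add: add_divide_distrib distrib_right)
qed

text \<open>Inside the box a subsequence converges at every site, hence in norm, because the box is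
  finite. Applying \<open>norm_le_box\<close> to differences, with \<open>T z (\<psi> n)\<close>
  tending to 0, makes the whole subsequence Cauchy.\<close>

lemma convergent_subsequence_of_approx:
  assumes ob: "off_box_bound c N z" "c > 0"
    and \<psi>: "\<And>n. norm (\<psi> n) = 1" and lim: "(\<lambda>n. T z (\<psi> n)) \<longlonglongrightarrow> 0"
  shows "\<exists>r \<phi>. strict_mono (r :: nat \<Rightarrow> nat) \<and> (\<lambda>n. \<psi> (r n)) \<longlonglongrightarrow> \<phi> \<and> norm \<phi> = 1 \<and> T z \<phi> = 0"
proof -
  have "norm (app (\<psi> n) x) \<le> 1" for n x using norm_app_le[of "\<psi> n" x] \<psi> by simp
  then have "bounded (range (\<lambda>n. app (\<psi> n) x))" for x by (intro boundedI[of _ 1]) auto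
  then obtain r :: "nat \<Rightarrow> nat" where r: "strict_mono r" "\<And>x. x \<in> {-N..N} \<Longrightarrow> convergent (\<lambda>n. app (\<psi> (r n)) x)"
    using pointwise_convergent_subsequence[of "{-N..N}" "\<lambda>n x. app (\<psi> n) x"] by auto
  define K where "K = 1 + (1 + cmod z) / c"
  have K: "K \<ge> 1" using ob(2) by (simp add: K_def)
  have C1: "Cauchy (\<lambda>n. cut {-N..N} (\<psi> (r n)))"
    by (rule convergent_Cauchy, rule cut_convergent) (use r in auto)
  have lim': "(\<lambda>n. T z (\<psi> (r n))) \<longlonglongrightarrow> 0"
    using LIMSEQ_subseq_LIMSEQ[OF lim r(1)] by (simp add: o_def)
  then have C2: "Cauchy (\<lambda>n. T z (\<psi> (r n)))" by (rule LIMSEQ_imp_Cauchy)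
  have "Cauchy (\<lambda>n. \<psi> (r n))"
  proof (rule CauchyI)
    fix e :: real assume e: "e > 0"
    obtain M1 where M1: "\<And>m n. m \<ge> M1 \<Longrightarrow> n \<ge> M1 \<Longrightarrow> norm (cut {-N..N} (\<psi> (r m)) - cut {-N..N} (\<psi> (r n))) < e / (2 * K)"
      using CauchyD[OF C1, of "e / (2 * K)"] e K by auto
    obtain M2 where M2: "\<And>m n. m \<ge> M2 \<Longrightarrow> n \<ge> M2 \<Longrightarrow> norm (T z (\<psi> (r m)) - T z (\<psi> (r n))) < e * c / 2"
      using CauchyD[OF C2, of "e * c / 2"] e ob(2) by auto
    have "norm (\<psi> (r m) - \<psi> (r n)) < e" if "m \<ge> max M1 M2" "n \<ge> max M1 M2" for m n
    proof -
      have "cut {-N..N} (\<psi> (r m) - \<psi> (r n)) = cut {-N..N} (\<psi> (r m)) - cut {-N..N} (\<psi> (r n))"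
        by (rule ell2_eqI) simp
      then have "norm (\<psi> (r m) - \<psi> (r n)) \<le> (1 / c) * norm (T z (\<psi> (r m)) - T z (\<psi> (r n)))
          + K * norm (cut {-N..N} (\<psi> (r m)) - cut {-N..N} (\<psi> (r n)))"
        using norm_le_box[OF ob, of "\<psi> (r m) - \<psi> (r n)"] by (simp add: T_diff K_def)
      also have "\<dots> < (1 / c) * (e * c / 2) + K * (e / (2 * K))"
        by (intro add_strict_mono mult_strict_left_mono M1 M2) (use that ob(2) K in auto)
      also have "\<dots> = e" using ob(2) K by simp
      finally show ?thesis .
    qed
    then show "\<exists>M. \<forall>m\<ge>M. \<forall>n\<ge>M. norm (\<psi> (r m) - \<psi> (r n)) < e" by blast
  qed
  then obtain \<phi> where \<phi>: "(\<lambda>n. \<psi> (r n)) \<longlonglongrightarrow> \<phi>" using Cauchy_convergent convergent_def by blast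
  have "(\<lambda>n. norm (\<psi> (r n))) \<longlonglongrightarrow> norm \<phi>" by (rule tendsto_norm[OF \<phi>])
  then have "norm \<phi> = 1" using \<psi> by (simp add: LIMSEQ_const_iff)
  moreover have "T z \<phi> = 0"
    using LIMSEQ_unique[OF bounded_linear.tendsto[OF bounded_linear_T \<phi>] lim'] .
  ultimately show ?thesis using r(1) \<phi> by blast
qed

lemma off_box_bound_shift:
  assumes "off_box_bound c N z"
  shows "off_box_bound (c - cmod (w - z)) N w"
  unfolding off_box_bound_def
proof (intro allI impI)
  fix \<psi> assume "\<forall>x. \<bar>x\<bar> \<le> N \<longrightarrow> app \<psi> x = 0"
  then have "c * norm \<psi> \<le> norm (T z \<psi>)" using assms by (auto simp: off_box_bound_def)
  then show "(c - cmod (w - z)) * norm \<psi> \<le> norm (T w \<psi>)"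
    using T_bound_shift[of z \<psi> w] by (simp add: left_diff_distrib)
qed

text \<open>Without bijectivity there is no lower bound, hence there are unit vectors that
  \<open>T z\<close> sends to 0 in the limit; compactness turns them into a genuine
  eigenvector.\<close>

lemma eigenvector_if_off_box_bound:
  assumes ob: "off_box_bound c N z" "c > 0" and "\<not> bij (T z)"
  shows "\<exists>\<phi>. norm \<phi> = 1 \<and> T z \<phi> = 0"
proof -
  have "\<exists>\<psi>. norm \<psi> = 1 \<and> norm (T z \<psi>) \<le> 1 / Suc n" for n
  proof -
    have "1 / real (Suc n) > 0" by simp
    then obtain x where x: "norm (T z x) < 1 / Suc n * norm x"
      using assms(3) unfolding bij_iff_bounded_below bounded_below_at_def by (meson not_le)
    then have "norm x > 0" by (cases "x = 0") auto
    then show ?thesis using x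
      by (intro exI[of _ "(1 / norm x) *\<^sub>R x"]) (auto simp: T_scaleR field_simps)
  qed
  then obtain \<psi> where \<psi>: "\<And>n. norm (\<psi> n) = 1" "\<And>n. norm (T z (\<psi> n)) \<le> 1 / Suc n" by metis
  have "(\<lambda>n. T z (\<psi> n)) \<longlonglongrightarrow> 0"
    by (rule Lim_null_comparison[OF _ LIMSEQ_inverse_real_of_nat])
      (use \<psi>(2) in \<open>auto simp: inverse_eq_divide\<close>)
  then show ?thesis using convergent_subsequence_of_approx[OF ob, of \<psi>, OF \<psi>(1)] by blast
qed

text \<open>By normality \<psi> is also in the kernel of the adjoint. Since \<open>inner\<close> is
  real, the argument pairs (w - z) \<phi> with (w - z) \<psi>, so that the scalar that comes out is
  the real number |w - z|^2.\<close>

lemma eigenvectors_orthogonal: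
  assumes "T w \<phi> = 0" "T z \<psi> = 0" "w \<noteq> z"
  shows "inner \<phi> \<psi> = 0"
proof -
  have T: "T z \<phi> = sc (w - z) \<phi>" using assms(1) by (simp add: T_def ell2.sc_diff_left)
  have "inner (sc (w - z) \<phi>) (sc (w - z) \<psi>) = inner \<phi> (Tadj z (sc (w - z) \<psi>))"
    unfolding T[symmetric] by (rule inner_T_left)
  also have "Tadj z (sc (w - z) \<psi>) = 0"
    using norm_Tadj[of z "sc (w - z) \<psi>"] assms(2) by (simp add: T_sc)
  finally have "inner \<phi> (sc (cnj (w - z) * (w - z)) \<psi>) = 0"
    by (simp add: ell2.inner_sc_left ell2.sc_sc)
  also have "cnj (w - z) * (w - z) = of_real ((cmod (w - z))\<^sup>2)"
    unfolding complex_norm_square by (rule mult.commute)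
  finally show ?thesis using assms(3) unfolding ell2.sc_of_real by simp
qed

lemma disc_if_off_box_bound:
  assumes ob: "off_box_bound c N z" "c > 0" and spec: "z \<in> spec (Gam p q \<circ> Coin a1 a2 b)"
  shows "z \<in> disc_spec (Gam p q \<circ> Coin a1 a2 b)"
proof -
  let ?W = "Gam p q \<circ> Coin a1 a2 b"
  obtain \<phi>0 where \<phi>0: "norm \<phi>0 = 1" "T z \<phi>0 = 0"
    using eigenvector_if_off_box_bound[OF ob] spec by (auto simp: spec_iff)
  have isolated: "\<exists>e>0. ball z e \<inter> spec ?W = {z}"
  \<comment> \<open>Spectral points accumulating at \<open>z\<close> would supply unit eigenvectors
    for values different from \<open>z\<close>. A subsequence converges to an eigenvector \<phi> for
    \<open>z\<close> that is orthogonal to all of them, hence to itself.\<close>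
  proof (rule ccontr)
    assume neg: "\<not> (\<exists>e>0. ball z e \<inter> spec ?W = {z})"
    have "\<exists>w \<psi>. w \<noteq> z \<and> cmod (w - z) \<le> 1 / Suc n \<and> norm \<psi> = 1 \<and> T w \<psi> = 0" for n
    proof -
      \<comment> \<open>The cap by \<open>c\<close> keeps the shifted constant c - |w - z| positive,
        so the nearby spectral point \<open>w\<close> is an eigenvalue as well.\<close>
      define e where "e = min (1 / Suc n) c"
      have e: "e > 0" using ob(2) by (simp add: e_def)
      then have "ball z e \<inter> spec ?W \<noteq> {z}" using neg by blast
      moreover have "z \<in> ball z e \<inter> spec ?W" using e spec by simp
      ultimately obtain w where w: "w \<in> ball z e" "w \<in> spec ?W" "w \<noteq> z" by blast
      have d: "cmod (w - z) < e" using w(1) by (simp add: dist_norm norm_minus_commute)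
      then have "c - cmod (w - z) > 0" by (simp add: e_def)
      from eigenvector_if_off_box_bound[OF off_box_bound_shift[OF ob(1)] this]
      obtain \<psi> where "norm \<psi> = 1" "T w \<psi> = 0" using w(2) by (auto simp: spec_iff)
      then show ?thesis using w(3) d by (intro exI[of _ w] exI[of _ \<psi>]) (auto simp: e_def)
    qed
    then obtain w \<psi> where w: "\<And>n. w n \<noteq> z" "\<And>n. cmod (w n - z) \<le> 1 / Suc n"
      and \<psi>: "\<And>n. norm (\<psi> n) = 1" "\<And>n. T (w n) (\<psi> n) = 0" by metis
    have "norm (T z (\<psi> n)) \<le> 1 / Suc n" for n
    proof -
      have "T z (\<psi> n) = sc (w n - z) (\<psi> n)" using \<psi>(2)[of n] by (simp add: T_def ell2.sc_diff_left)
      then show ?thesis using w(2)[of n] by (simp add: \<psi>(1))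
    qed
    then have "(\<lambda>n. T z (\<psi> n)) \<longlonglongrightarrow> 0"
      by (intro Lim_null_comparison[OF _ LIMSEQ_inverse_real_of_nat]) (auto simp: inverse_eq_divide)
    then obtain r \<phi> where r: "(\<lambda>n. \<psi> (r n)) \<longlonglongrightarrow> \<phi>" "norm \<phi> = 1" "T z \<phi> = 0"
      using convergent_subsequence_of_approx[OF ob, of \<psi>, OF \<psi>(1)] by blast
    have "inner (\<psi> (r n)) \<phi> = 0" for n by (rule eigenvectors_orthogonal[OF \<psi>(2) r(3) w(1)])
    then have "(\<lambda>n. 0) \<longlonglongrightarrow> inner \<phi> \<phi>" using tendsto_inner[OF r(1) tendsto_const[of \<phi>]] by simp
    then have "inner \<phi> \<phi> = 0" by (simp add: LIMSEQ_const_iff)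
    then show False using r(2) by simp
  qed
  have "app \<phi>0 \<in> eigenspace ?W z" using \<phi>0(2) by (simp add: eigenspace_eq)
  moreover have "app \<phi>0 \<noteq> (\<lambda>_. (0, 0))"
  proof
    assume "app \<phi>0 = (\<lambda>_. (0, 0))"
    then have "\<phi>0 = 0" by (intro ell2_eqI) (simp add: zero_prod_def)
    then show False using \<phi>0(1) by simp
  qed
  ultimately have nontriv: "eigenspace ?W z \<noteq> {\<lambda>_. (0, 0)}" by blast
  have "fin_dim (eigenspace ?W z)"
  proof (rule fin_dim_if_coordinates_injective)
    \<comment> \<open>By \<open>norm_le_box\<close>, an eigenvector vanishing on the box is zero, so
      the finitely many components at box sites determine it.\<close>
    let ?S = "(\<lambda>x \<psi>. fst (\<psi> x)) ` {-N..N} \<union> (\<lambda>x \<psi>. snd (\<psi> x)) ` {-N..N} :: (state \<Rightarrow> complex) set"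
    show "finite ?S" by simp
    fix \<psi> \<phi> :: state and d
    show "f (\<lambda>x. \<psi> x - csmult d (\<phi> x)) = f \<psi> - d * f \<phi>" if "f \<in> ?S" for f
      using that by (auto simp: csmult_def)
    assume "\<psi> \<in> eigenspace ?W z"
    then obtain \<psi>' where \<psi>': "\<psi> = app \<psi>'" "T z \<psi>' = 0" by (auto simp: eigenspace_eq)
    show "\<psi> = (\<lambda>_. 0)" if "\<forall>f\<in>?S. f \<psi> = 0"
    proof -
      have "app (cut {-N..N} \<psi>') x = app 0 x" for x
        using that by (auto simp: \<psi>' prod_eq_iff)
      then have "cut {-N..N} \<psi>' = 0" by (rule ell2_eqI)
      then have "\<psi>' = 0" using norm_le_box[OF ob, of \<psi>'] \<psi>'(2) by simp
      then show ?thesis by (auto simp: \<psi>')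
    qed
    assume "\<phi> \<in> eigenspace ?W z"
    then obtain \<phi>' where \<phi>': "\<phi> = app \<phi>'" "T z \<phi>' = 0" by (auto simp: eigenspace_eq)
    have "T z (\<psi>' - sc d \<phi>') = 0" by (simp add: T_diff T_sc \<psi>' \<phi>')
    moreover have "(\<lambda>x. \<psi> x - csmult d (\<phi> x)) = app (\<psi>' - sc d \<phi>')" by (auto simp: \<psi>' \<phi>')
    ultimately show "(\<lambda>x. \<psi> x - csmult d (\<phi> x)) \<in> eigenspace ?W z" by (simp add: eigenspace_eq)
  qed
  then show ?thesis using spec isolated nontriv unfolding disc_spec_def by blast
qed

end

section \<open>Comparison with the limit coins\<close>

lemma exists_kernel_vector_2x2:
  fixes A B C D :: complex
  assumes "A * D - B * C = 0"
  shows "\<exists>u v. (u, v) \<noteq> (0, 0) \<and> A * u + B * v = 0 \<and> C * u + D * v = 0"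
proof (cases "A = 0 \<and> B = 0")
  case True
  show ?thesis
  proof (cases "C = 0 \<and> D = 0")
    case True
    then show ?thesis using \<open>A = 0 \<and> B = 0\<close> by (intro exI[of _ 1] exI[of _ 0]) auto
  next
    case False
    then show ?thesis using \<open>A = 0 \<and> B = 0\<close>
      by (intro exI[of _ "- D"] exI[of _ C]) (auto simp: algebra_simps)
  qed
next
  case False
  then show ?thesis using assms
    by (intro exI[of _ "- B"] exI[of _ A]) (auto simp: algebra_simps)
qed

lemma norm_Gam_le:
  assumes pq: "p\<^sup>2 + (norm q)\<^sup>2 = 1" and \<psi>: "\<And>y. norm (\<psi> y) \<le> B"
  shows "norm (Gam p q \<psi> x) \<le> 4 * B"
proof -
  have "p\<^sup>2 \<le> 1" "(norm q)\<^sup>2 \<le> 1" using pq zero_le_power2[of p] zero_le_power2[of "norm q"] by linarith+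
  then have pq1: "\<bar>p\<bar> \<le> 1" "norm q \<le> 1" by (simp_all add: abs_square_le_1)
  have comp: "cmod (fst (\<psi> y)) \<le> B" "cmod (snd (\<psi> y)) \<le> B" for y
    using \<psi>[of y] by (metis norm_fst_le norm_snd_le prod.collapse order_trans)+
  have le: "norm (c * u) \<le> B" if "norm c \<le> 1" "norm u \<le> B" for c u :: complex
    using mult_mono[OF that] by (simp add: norm_mult)
  have "norm (Gam p q \<psi> x) \<le> norm (of_real p * fst (\<psi> x) + q * snd (\<psi> (x + 1)))
      + norm (cnj q * fst (\<psi> (x - 1)) - of_real p * snd (\<psi> x))"
    unfolding Gam_def by (rule norm_Pair_le)
  also have "\<dots> \<le> (B + B) + (B + B)"
    by (intro add_mono order_trans[OF norm_triangle_ineq] order_trans[OF norm_triangle_ineq4] le comp)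
      (use pq1 in auto)
  finally show ?thesis by simp
qed

text \<open>The equations say that \<open>v\<close> is an eigenvector, for \<open>z\<close>, of the
  Fourier symbol of the constant-coin walk, in which the left shift is replaced by \<omega>. Then x
  \<mapsto> \<omega>^x v is a bounded solution of the eigenvalue equation that is not square
  summable.\<close>

definition plane_wave_data ::
    "real \<Rightarrow> complex \<Rightarrow> real \<Rightarrow> real \<Rightarrow> complex \<Rightarrow> complex \<Rightarrow> complex \<Rightarrow> complex \<times> complex \<Rightarrow> bool" where
  "plane_wave_data p q A1 A2 B z \<omega> v \<longleftrightarrow> cmod \<omega> = 1 \<and> v \<noteq> 0 \<and>
     of_real p * (of_real A1 * fst v + cnj B * snd v) + q * \<omega> * (B * fst v + of_real A2 * snd v) = z * fst v \<and>
     cnj q * cnj \<omega> * (of_real A1 * fst v + cnj B * snd v) - of_real p * (B * fst v + of_real A2 * snd v) = z * snd v"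

context walk
begin

definition dev :: "real \<Rightarrow> real \<Rightarrow> complex \<Rightarrow> int \<Rightarrow> real" where
  "dev A1 A2 B x = \<bar>a1 x - A1\<bar> + \<bar>a2 x - A2\<bar> + 2 * cmod (b x - B)"

lemma eventually_dev_le:
  assumes "(a1 \<longlongrightarrow> A1) F" "(a2 \<longlongrightarrow> A2) F" "(b \<longlongrightarrow> B) F" "d > 0"
  shows "\<forall>\<^sub>F x in F. dev A1 A2 B x \<le> d"
proof -
  have "(dev A1 A2 B \<longlongrightarrow> \<bar>A1 - A1\<bar> + \<bar>A2 - A2\<bar> + 2 * cmod (B - B)) F"
    unfolding dev_def[abs_def] by (intro tendsto_intros assms)
  then have "\<forall>\<^sub>F x in F. dev A1 A2 B x < d" using assms(4) by (intro order_tendstoD(2)) auto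
  then show ?thesis by eventually_elim simp
qed

lemma lower_bound_from_model:
  assumes w: "walk p q (\<lambda>_. A1) (\<lambda>_. A2) (\<lambda>_. B)" and c: "c > 0"
    and le: "\<And>\<psi>. c * norm \<psi> \<le> norm (walk.step p q (\<lambda>_. A1) (\<lambda>_. A2) (\<lambda>_. B) \<psi> - sc z \<psi>)"
    and dev: "\<And>x. app \<psi> x \<noteq> 0 \<Longrightarrow> dev A1 A2 B x \<le> c / 2"
  shows "c / 2 * norm \<psi> \<le> norm (T z \<psi>)"
proof -
  let ?w = "walk.step p q (\<lambda>_. A1) (\<lambda>_. A2) (\<lambda>_. B)"
  have "norm (step \<psi> - ?w \<psi>) \<le> c / 2 * norm \<psi>"
    by (rule norm_step_diff_le[OF w]) (use c dev in \<open>auto simp: dev_def\<close>)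
  moreover have "norm (?w \<psi> - sc z \<psi>) \<le> norm (T z \<psi>) + norm (step \<psi> - ?w \<psi>)"
    using norm_triangle_ineq4[of "T z \<psi>" "step \<psi> - ?w \<psi>"] by (simp add: T_def)
  ultimately show ?thesis using le[of \<psi>] by simp
qed

text \<open>A state vanishing near the origin splits into two halves that \<open>T z\<close> does
  not mix, and each half sees almost a constant coin. One factor 2 of the loss to c / 4 pays for the
  deviation of the coin, the other for adding the two halves.\<close>

lemma off_box_bound_from_limits:
  assumes wL: "walk p q (\<lambda>_. A1) (\<lambda>_. A2) (\<lambda>_. B)" and wR: "walk p q (\<lambda>_. A1') (\<lambda>_. A2') (\<lambda>_. B')"
    and limL: "(a1 \<longlongrightarrow> A1) at_bot" "(a2 \<longlongrightarrow> A2) at_bot" "(b \<longlongrightarrow> B) at_bot"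
    and limR: "(a1 \<longlongrightarrow> A1') at_top" "(a2 \<longlongrightarrow> A2') at_top" "(b \<longlongrightarrow> B') at_top"
    and c: "c > 0"
    and leL: "\<And>\<psi>. c * norm \<psi> \<le> norm (walk.step p q (\<lambda>_. A1) (\<lambda>_. A2) (\<lambda>_. B) \<psi> - sc z \<psi>)"
    and leR: "\<And>\<psi>. c * norm \<psi> \<le> norm (walk.step p q (\<lambda>_. A1') (\<lambda>_. A2') (\<lambda>_. B') \<psi> - sc z \<psi>)"
  shows "\<exists>N. off_box_bound (c / 4) N z"
proof -
  have "c / 2 > 0" using c by simp
  note ev = eventually_dev_le[OF limL this] eventually_dev_le[OF limR this]
  obtain N1 where N1: "\<And>x. x \<le> N1 \<Longrightarrow> dev A1 A2 B x \<le> c / 2"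
    using ev(1) unfolding eventually_at_bot_linorder by blast
  obtain N2 where N2: "\<And>x. x \<ge> N2 \<Longrightarrow> dev A1' A2' B' x \<le> c / 2"
    using ev(2) unfolding eventually_at_top_linorder by blast
  \<comment> \<open>The lower bound 1 makes the state vanish at -1, 0 and 1, so that cutting between
    -1 and 0 commutes with \<open>T z\<close>.\<close>
  define N where "N = max 1 (max \<bar>N1\<bar> \<bar>N2\<bar>)"
  have "c / 4 * norm \<psi> \<le> norm (T z \<psi>)" if \<psi>: "\<And>x. \<bar>x\<bar> \<le> N \<Longrightarrow> app \<psi> x = 0" for \<psi>
  proof -
    have \<psi>0: "app \<psi> (- 1) = 0" "app \<psi> 0 = 0" "app \<psi> 1 = 0" using \<psi> by (auto simp: N_def)
    have T0: "app (T z 0) x = 0" for x by simp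
    have R: "T z (cut {0..} \<psi>) = cut {0..} (T z \<psi>)"
    proof (rule ell2_eqI)
      fix x :: int
      consider "x \<ge> 1" | "x = 0" | "x = -1" | "x < -1" by linarith
      then show "app (T z (cut {0..} \<psi>)) x = app (cut {0..} (T z \<psi>)) x"
      proof cases
        assume "x = -1"
        then show ?thesis using app_T_local[of "cut {0..} \<psi>" x 0 z] \<psi>0 by (simp add: T0)
      next
        assume "x < -1"
        then show ?thesis using app_T_local[of "cut {0..} \<psi>" x 0 z] by (simp add: T0)
      qed (use app_T_local[of "cut {0..} \<psi>" x \<psi> z] \<psi>0 in \<open>auto\<close>)
    qed
    have L: "T z (cut {..<0} \<psi>) = cut {..<0} (T z \<psi>)"
    proof (rule ell2_eqI)
      fix x :: int
      consider "x < -1" | "x = -1" | "x = 0" | "x \<ge> 1" by linarith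
      then show "app (T z (cut {..<0} \<psi>)) x = app (cut {..<0} (T z \<psi>)) x"
      proof cases
        assume "x = 0"
        then show ?thesis using app_T_local[of "cut {..<0} \<psi>" x 0 z] \<psi>0 by (simp add: T0)
      next
        assume "x \<ge> 1"
        then show ?thesis using app_T_local[of "cut {..<0} \<psi>" x 0 z] by (simp add: T0)
      qed (use app_T_local[of "cut {..<0} \<psi>" x \<psi> z] \<psi>0 in \<open>auto\<close>)
    qed
    have "c / 2 * norm (cut {0..} \<psi>) \<le> norm (T z (cut {0..} \<psi>))"
    proof (rule lower_bound_from_model[OF wR c leR])
      fix x assume "app (cut {0..} \<psi>) x \<noteq> 0"
      then have "x \<ge> 0" "\<not> \<bar>x\<bar> \<le> N" using \<psi> by (auto split: if_splits)
      then show "dev A1' A2' B' x \<le> c / 2" by (intro N2) (auto simp: N_def)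
    qed
    also have "\<dots> \<le> norm (T z \<psi>)" unfolding R by (rule norm_cut_le)
    finally have 1: "c / 2 * norm (cut {0..} \<psi>) \<le> norm (T z \<psi>)" .
    have "c / 2 * norm (cut {..<0} \<psi>) \<le> norm (T z (cut {..<0} \<psi>))"
    proof (rule lower_bound_from_model[OF wL c leL])
      fix x assume "app (cut {..<0} \<psi>) x \<noteq> 0"
      then have "x < 0" "\<not> \<bar>x\<bar> \<le> N" using \<psi> by (auto split: if_splits)
      then show "dev A1 A2 B x \<le> c / 2" by (intro N1) (auto simp: N_def)
    qed
    also have "\<dots> \<le> norm (T z \<psi>)" unfolding L by (rule norm_cut_le)
    finally have 2: "c / 2 * norm (cut {..<0} \<psi>) \<le> norm (T z \<psi>)" .
    have "\<psi> = cut {0..} \<psi> + cut {..<0} \<psi>" by (rule ell2_eqI) auto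
    then have "norm \<psi> \<le> norm (cut {0..} \<psi>) + norm (cut {..<0} \<psi>)" by (metis norm_triangle_ineq)
    then have "c / 2 * norm \<psi> \<le> c / 2 * (norm (cut {0..} \<psi>) + norm (cut {..<0} \<psi>))"
      using c by (intro mult_left_mono) auto
    then show ?thesis using 1 2 by (simp add: distrib_left)
  qed
  then show ?thesis unfolding off_box_bound_def by blast
qed

text \<open>A plane wave cut to n sites has norm sqrt n |v|. Under the constant coin the eigenvalue
  equation fails at no more than four sites, by at most 5 |v| each, so the error is at most sqrt (4
  * 25) |v| = 10 |v|, independent of n. The term \<open>d\<close> accounts for the true
  coin.\<close>

lemma block_approx:
  fixes n :: nat
  assumes w: "walk p q (\<lambda>_. A1) (\<lambda>_. A2) (\<lambda>_. B)" and pw: "plane_wave_data p q A1 A2 B z \<omega> v"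
    and z: "cmod z = 1" and n: "n > 0" and d: "d \<ge> 0"
    and dev: "\<And>x. x \<in> {m..<m + int n} \<Longrightarrow> dev A1 A2 B x \<le> d"
  shows "\<exists>\<psi>. norm \<psi> = 1 \<and> (\<forall>x. app \<psi> x \<noteq> 0 \<longrightarrow> x \<in> {m..<m + int n}) \<and> norm (T z \<psi>) \<le> d + 10 / sqrt n"
proof -
  interpret w: walk p q "\<lambda>_. A1" "\<lambda>_. A2" "\<lambda>_. B" by (rule w)
  let ?S = "{m..<m + int n}"
  have \<omega>: "cmod \<omega> = 1" "\<omega> \<noteq> 0" and v: "norm v > 0" using pw by (auto simp: plane_wave_data_def)
  have "\<omega> * cnj \<omega> = 1" using \<omega>(1) by (simp add: complex_norm_square[symmetric])
  then have inv: "inverse \<omega> = cnj \<omega>" by (rule inverse_unique)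
  define g where "g x = csmult (\<omega> powi x) v" for x
  have ng: "norm (g x) = norm v" for x by (simp add: g_def norm_csmult norm_power_int \<omega>)
  have Wg: "Gam p q (Coin (\<lambda>_. A1) (\<lambda>_. A2) (\<lambda>_. B) g) x = csmult z (g x)" for x
  proof -
    have s: "\<omega> powi (x + 1) = \<omega> powi x * \<omega>" "\<omega> powi (x - 1) = \<omega> powi x * cnj \<omega>"
      using \<omega>(2) by (simp_all add: power_int_add power_int_diff divide_inverse inv)
    define k where "k = \<omega> powi x"
    have "fst (Gam p q (Coin (\<lambda>_. A1) (\<lambda>_. A2) (\<lambda>_. B) g) x)
      = k * (of_real p * (of_real A1 * fst v + cnj B * snd v) + q * \<omega> * (B * fst v + of_real A2 * snd v))"
      unfolding Gam_def Coin_def g_def csmult_def fst_conv snd_conv s k_def[symmetric]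
      by (simp add: algebra_simps)
    moreover have "snd (Gam p q (Coin (\<lambda>_. A1) (\<lambda>_. A2) (\<lambda>_. B) g) x)
      = k * (cnj q * cnj \<omega> * (of_real A1 * fst v + cnj B * snd v) - of_real p * (B * fst v + of_real A2 * snd v))"
      unfolding Gam_def Coin_def g_def csmult_def fst_conv snd_conv s k_def[symmetric]
      by (simp add: algebra_simps)
    ultimately show ?thesis using pw unfolding plane_wave_data_def
      by (simp add: prod_eq_iff g_def csmult_def k_def mult.left_commute)
  qed
  define f where "f x = (if x \<in> ?S then g x else 0)" for x
  have "(\<lambda>x. (norm (f x))\<^sup>2) summable_on UNIV"
    by (rule finite_nonzero_values_imp_summable_on, rule finite_subset[of _ ?S]) (auto simp: f_def)
  then have "f \<in> l2" by (simp add: l2_def)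
  define \<psi> where "\<psi> = Abs_ell2 f"
  have app: "app \<psi> = f" using \<open>f \<in> l2\<close> by (simp add: \<psi>_def Abs_ell2_inverse)
  have "(norm \<psi>)\<^sup>2 = (\<Sum>x\<in>?S. (norm v)\<^sup>2)"
    by (subst norm_finite_support[of ?S]) (auto simp: app f_def ng intro!: sum.cong)
  also have "\<dots> = (sqrt n * norm v)\<^sup>2" by (simp add: power_mult_distrib)
  finally have npsi: "norm \<psi> = sqrt n * norm v" by (rule power2_eq_imp_eq) auto
  have psi0: "norm \<psi> > 0" using npsi v n by simp
  \<comment> \<open>The sites on either side of the two ends of the block. They may coincide for
    small n, hence only card E <= 4 is claimed below.\<close>
  define E where "E = {m - 1, m, m + int n - 1, m + int n}"
  have E0: "app (w.T z \<psi>) x = 0" if "x \<notin> E" for x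
  proof (cases "x \<in> ?S")
    case True
    then have "x - 1 \<in> ?S" "x + 1 \<in> ?S" using that by (auto simp: E_def)
    then have "Gam p q (Coin (\<lambda>_. A1) (\<lambda>_. A2) (\<lambda>_. B) f) x = Gam p q (Coin (\<lambda>_. A1) (\<lambda>_. A2) (\<lambda>_. B) g) x"
      using True by (simp add: Gam_def Coin_def f_def)
    then show ?thesis using True by (simp add: w.app_T app Wg) (simp add: f_def)
  next
    case False
    then have "x - 1 \<notin> ?S" "x + 1 \<notin> ?S" using that by (auto simp: E_def)
    then have "f (x - 1) = 0" "f x = 0" "f (x + 1) = 0" using False unfolding f_def by meson+
    then show ?thesis using w.app_T_local[of \<psi> x 0 z] by (simp add: app)
  qed
  have E5: "norm (app (w.T z \<psi>) x) \<le> 5 * norm v" for x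
  proof -
    have "norm (f y) \<le> norm v" for y using v by (simp add: f_def ng)
    then have "norm (Gam p q (Coin (\<lambda>_. A1) (\<lambda>_. A2) (\<lambda>_. B) f) x) \<le> 4 * norm v"
      by (intro norm_Gam_le[OF pq]) (simp add: w.norm_Coin)
    moreover have "norm (csmult z (f x)) \<le> norm v" using \<open>\<And>y. norm (f y) \<le> norm v\<close> by (simp add: norm_csmult z)
    ultimately show ?thesis unfolding w.app_T app
      by (intro order_trans[OF norm_triangle_ineq4]) linarith
  qed
  have "(norm (w.T z \<psi>))\<^sup>2 = (\<Sum>x\<in>E. (norm (app (w.T z \<psi>) x))\<^sup>2)"
    by (rule norm_finite_support) (auto simp: E_def E0[unfolded E_def])
  also have "\<dots> \<le> (\<Sum>x\<in>E. (5 * norm v)\<^sup>2)" by (intro sum_mono power_mono E5) auto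
  also have "\<dots> = real (card E) * (5 * norm v)\<^sup>2" by simp
  also have "\<dots> \<le> 4 * (5 * norm v)\<^sup>2"
  proof -
    have "card E \<le> 4" unfolding E_def using card_length[of "[m - 1, m, m + int n - 1, m + int n]"] by simp
    then show ?thesis by (intro mult_right_mono) auto
  qed
  also have "\<dots> = (10 * norm v)\<^sup>2" by (simp add: power_mult_distrib)
  finally have wT: "norm (w.T z \<psi>) \<le> 10 * norm v" by (rule power2_le_imp_le) simp
  have dif: "norm (step \<psi> - w.step \<psi>) \<le> d * norm \<psi>"
    by (rule norm_step_diff_le[OF w d]) (use dev in \<open>auto simp: dev_def app f_def split: if_splits\<close>)
  have "T z \<psi> = w.T z \<psi> + (step \<psi> - w.step \<psi>)" by (simp add: T_def w.T_def)
  then have "norm (T z \<psi>) \<le> 10 * norm v + d * norm \<psi>"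
    using norm_triangle_ineq[of "w.T z \<psi>" "step \<psi> - w.step \<psi>"] wT dif by simp
  then have "norm (T z \<psi>) / norm \<psi> \<le> (10 * norm v + d * norm \<psi>) / norm \<psi>"
    using psi0 by (intro divide_right_mono) auto
  also have "\<dots> = d + 10 / sqrt n" using psi0 v n unfolding add_divide_distrib by (simp add: npsi)
  finally have "norm (T z ((1 / norm \<psi>) *\<^sub>R \<psi>)) \<le> d + 10 / sqrt n" by (simp add: T_scaleR)
  then show ?thesis using psi0
    by (intro exI[of _ "(1 / norm \<psi>) *\<^sub>R \<psi>"]) (auto simp: app f_def split: if_splits)
qed

lemma far_approx_if_plane_wave:
  assumes w: "walk p q (\<lambda>_. A1) (\<lambda>_. A2) (\<lambda>_. B)" and pw: "plane_wave_data p q A1 A2 B z \<omega> v"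
    and z: "cmod z = 1" and F: "F = at_top \<or> F = at_bot"
    and lim: "(a1 \<longlongrightarrow> A1) F" "(a2 \<longlongrightarrow> A2) F" "(b \<longlongrightarrow> B) F"
  shows "far_approx z"
  unfolding far_approx_def
proof (intro allI impI)
  fix N :: int and e :: real assume e: "e > 0"
  \<comment> \<open>This length makes 10 / sqrt n < e / 2; the other half of \<open>e\<close> is
    left for the deviation of the coin.\<close>
  obtain n :: nat where n: "real n > (20 / e)\<^sup>2" using reals_Archimedean2 by blast
  then have "real n > 0" using zero_le_power2[of "20 / e"] by linarith
  then have n0: "n > 0" by simp
  have "20 / e < sqrt n" using n by (intro real_less_rsqrt) auto
  then have "20 < e * sqrt n" using e by (simp add: pos_divide_less_eq mult.commute)
  moreover have "sqrt n > 0" using n0 by simp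
  ultimately have small: "10 / sqrt n < e / 2" by (simp add: pos_divide_less_eq)
  have ev: "\<forall>\<^sub>F x in F. dev A1 A2 B x \<le> e / 2" by (rule eventually_dev_le[OF lim]) (use e in simp)
  obtain m where m: "\<And>x. x \<in> {m..<m + int n} \<Longrightarrow> \<bar>x\<bar> > N"
    "\<And>x. x \<in> {m..<m + int n} \<Longrightarrow> dev A1 A2 B x \<le> e / 2"
  proof (cases "F = at_top")
    case True
    obtain k where k: "\<forall>x\<ge>k. dev A1 A2 B x \<le> e / 2"
      using ev unfolding True eventually_at_top_linorder ..
    show ?thesis
    proof (rule that[of "max k (\<bar>N\<bar> + 1)"])
      fix x assume "x \<in> {max k (\<bar>N\<bar> + 1)..<max k (\<bar>N\<bar> + 1) + int n}"
      then have "k \<le> x" "\<bar>N\<bar> + 1 \<le> x" by auto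
      then show "N < \<bar>x\<bar>" "dev A1 A2 B x \<le> e / 2" using k by auto
    qed
  next
    case False
    then have F: "F = at_bot" using F by simp
    obtain k where k: "\<forall>x\<le>k. dev A1 A2 B x \<le> e / 2"
      using ev unfolding F eventually_at_bot_linorder ..
    show ?thesis
    proof (rule that[of "min k (- \<bar>N\<bar> - 1) - int n"])
      fix x assume "x \<in> {min k (- \<bar>N\<bar> - 1) - int n..<min k (- \<bar>N\<bar> - 1) - int n + int n}"
      then have "x < k" "x < - \<bar>N\<bar> - 1" by auto
      then show "N < \<bar>x\<bar>" "dev A1 A2 B x \<le> e / 2" using k by auto
    qed
  qed
  obtain \<psi> where \<psi>: "norm \<psi> = 1" "\<And>x. app \<psi> x \<noteq> 0 \<Longrightarrow> x \<in> {m..<m + int n}"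
    "norm (T z \<psi>) \<le> e / 2 + 10 / sqrt n"
    using block_approx[OF w pw z n0 _ m(2)] e by (metis half_gt_zero less_imp_le)
  have "N < \<bar>x\<bar> \<and> \<bar>x\<bar> \<le> \<bar>m\<bar> + int n" if "app \<psi> x \<noteq> 0" for x
    using \<psi>(2)[OF that] m(1)[of x] by auto
  moreover have "norm (T z \<psi>) < e" using \<psi>(3) small by simp
  ultimately show "\<exists>M \<psi>. norm \<psi> = 1 \<and> (\<forall>x. app \<psi> x \<noteq> 0 \<longrightarrow> N < \<bar>x\<bar> \<and> \<bar>x\<bar> \<le> M) \<and> norm (T z \<psi>) < e"
    using \<psi>(1) by blast
qed

end

section \<open>Spectrum of a walk with constant coin\<close>

lemma constant_coin_bounded_below:
  assumes w: "walk p q (\<lambda>_. A1) (\<lambda>_. A2) (\<lambda>_. B)" and z: "cmod z = 1" and I: "Re z \<notin> I_set p q A1 A2 B"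
  shows "\<exists>c>0. \<forall>\<psi>. c * norm \<psi> \<le> norm (walk.step p q (\<lambda>_. A1) (\<lambda>_. A2) (\<lambda>_. B) \<psi> - sc z \<psi>)"
proof -
  interpret w: walk p q "\<lambda>_. A1" "\<lambda>_. A2" "\<lambda>_. B" by (rule w)
  have "\<exists>c>0. \<forall>\<psi>. c * norm \<psi> \<le> norm (w.T z \<psi>)"
  proof (cases "trivial_coin A1 A2 B")
    case True
    \<comment> \<open>For a trivial coin the walk is plus or minus the shift operator, an
      involution, so (U + z)(U - z) is the scalar 1 - z^2. It vanishes only at z = 1 and z =
      -1.\<close>
    have inv: "w.step_inv \<psi> = w.step \<psi>" for \<psi>
      by (rule ell2_eqI, unfold w.app_step w.app_step_inv Gam_def Coin_def)
        (use True in \<open>auto simp: trivial_coin_def\<close>)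
    have "w.T (- z) (w.T z \<psi>) = sc (1 - z * z) \<psi>" for \<psi>
    proof -
      have "w.step (w.step \<psi>) = \<psi>" using w.UV[of \<psi>] unfolding inv .
      then show ?thesis
        by (simp add: w.T_def w.U_diff w.U_sc ell2.sc_minus_left ell2.sc_diff_left ell2.sc_diff_right ell2.sc_sc)
    qed
    then have "cmod (1 - z * z) * norm \<psi> \<le> 2 * norm (w.T z \<psi>)" for \<psi>
      using w.norm_T_le[of "- z" "w.T z \<psi>"] z by simp
    then have "cmod (1 - z * z) / 2 * norm \<psi> \<le> norm (w.T z \<psi>)" for \<psi> by (simp add: field_simps)
    moreover have "1 - z * z \<noteq> 0"
    proof
      assume "1 - z * z = 0"
      then have "(z - 1) * (z + 1) = 0" by (simp add: algebra_simps)
      then have "z = 1 \<or> z = - 1" by (auto simp: eq_neg_iff_add_eq_0)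
      then show False using I True by (auto simp: I_set_def)
    qed
    ultimately show ?thesis by (intro exI[of _ "cmod (1 - z * z) / 2"]) auto
  next
    case False
    \<comment> \<open>If B is nonzero the coin relation forces this. If B = 0 both entries are 1 or
      -1, and equal signs would make the coin trivial.\<close>
    then have A2: "A2 = - A1" using w.coin1 w.coin2 w.b_zero_or unfolding trivial_coin_def
      by (auto simp: power2_eq_1_iff)
    define c where "c = \<bar>p * A1 - Re z\<bar> - cmod (q * B)"
    have c: "c > 0" using I False by (auto simp: I_set_def c_def)
    have "c * norm \<psi> \<le> norm (w.T z \<psi>)" for \<psi>
    proof -
      define \<eta> where "\<eta> = w.step \<psi> + w.step_inv \<psi> - (2 * Re z) *\<^sub>R \<psi>"
      \<comment> \<open>U plus its inverse is the anticommutator of shift and coin. With a2 = -a1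
        its off-diagonal entries cancel and both components carry the same scalar operator, 2 p a +
        q b L plus the adjoint of q b L.\<close>
      have chi: "\<eta> = (2 * (p * A1 - Re z)) *\<^sub>R \<psi> + (sc (q * B) (translate 1 \<psi>) + sc (cnj (q * B)) (translate (-1) \<psi>))"
      proof (rule ell2_eqI)
        fix x
        obtain u v where uv: "app \<psi> x = (u, v)" by fastforce
        obtain u1 v1 where uv1: "app \<psi> (x + 1) = (u1, v1)" by fastforce
        obtain u2 v2 where uv2: "app \<psi> (x - 1) = (u2, v2)" by fastforce
        show "app \<eta> x = app ((2 * (p * A1 - Re z)) *\<^sub>R \<psi>
            + (sc (q * B) (translate 1 \<psi>) + sc (cnj (q * B)) (translate (-1) \<psi>))) x"
          unfolding \<eta>_def app_diff app_add app_scaleR app_sc app_translate w.app_step w.app_step_inv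
            Gam_def Coin_def csmult_def
          by (simp add: A2 uv uv1 uv2 scaleR_conv_of_real) (simp add: algebra_simps)
      qed
      \<comment> \<open>On the circle (U - cnj z)(U - z) = U^2 - 2 (Re z) U + 1, which is U applied
        to \<eta>. A lower bound on \<eta> therefore bounds \<open>w.T z \<psi>\<close> from
        below.\<close>
      have "w.T (cnj z) (w.T z \<psi>) = w.step \<eta>"
      proof -
        have "cnj z * z = 1" using z by (simp add: complex_norm_square[symmetric] mult.commute)
        moreover have "sc z (w.step \<psi>) + sc (cnj z) (w.step \<psi>) = (2 * Re z) *\<^sub>R w.step \<psi>"
          unfolding ell2.sc_add_left[symmetric] complex_add_cnj ell2.sc_of_real by simp
        ultimately show ?thesis
          by (simp add: w.T_def \<eta>_def w.U_diff w.U_add w.U_sc w.U_scaleR ell2.sc_diff_right ell2.sc_sc algebra_simps)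
      qed
      then have "norm \<eta> \<le> 2 * norm (w.T z \<psi>)"
        using w.norm_T_le[of "cnj z" "w.T z \<psi>"] z by simp
      moreover have "norm \<eta> \<ge> 2 * \<bar>p * A1 - Re z\<bar> * norm \<psi> - 2 * cmod (q * B) * norm \<psi>"
      proof -
        have "norm (sc (q * B) (translate 1 \<psi>) + sc (cnj (q * B)) (translate (-1) \<psi>)) \<le> 2 * cmod (q * B) * norm \<psi>"
          by (rule order_trans[OF norm_triangle_ineq]) (simp add: norm_mult)
        moreover have "norm ((2 * (p * A1 - Re z)) *\<^sub>R \<psi>) = 2 * \<bar>p * A1 - Re z\<bar> * norm \<psi>"
          unfolding norm_scaleR abs_mult by simp
        ultimately show ?thesis unfolding chi
          using norm_diff_ineq[of "(2 * (p * A1 - Re z)) *\<^sub>R \<psi>" "sc (q * B) (translate 1 \<psi>) + sc (cnj (q * B)) (translate (-1) \<psi>)"]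
          by linarith
      qed
      ultimately show ?thesis by (simp add: c_def left_diff_distrib)
    qed
    then show ?thesis using c by blast
  qed
  then show ?thesis by (simp add: w.T_def)
qed

lemma exists_unit_with_Re:
  fixes k :: complex and t :: real
  assumes "\<bar>t\<bar> \<le> cmod k"
  shows "\<exists>\<omega>. cmod \<omega> = 1 \<and> Re (k * \<omega>) = t"
proof (cases "k = 0")
  case True
  then show ?thesis using assms by (intro exI[of _ 1]) auto
next
  case False
  define s where "s = t / cmod k"
  have "\<bar>s\<bar> \<le> 1" using assms False by (simp add: s_def)
  then have s: "s\<^sup>2 \<le> 1" by (simp add: abs_square_le_1)
  define \<omega> where "\<omega> = cnj k / of_real (cmod k) * Complex s (sqrt (1 - s\<^sup>2))"
  have "cmod (Complex s (sqrt (1 - s\<^sup>2))) = 1" using s by (simp add: complex_norm)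
  then have "cmod \<omega> = 1" using False by (simp add: \<omega>_def norm_mult norm_divide)
  moreover have "k * \<omega> = of_real (cmod k) * Complex s (sqrt (1 - s\<^sup>2))"
  proof -
    have "k * cnj k = of_real (cmod k) * of_real (cmod k)"
      using complex_norm_square[of k] by (simp add: power2_eq_square)
    then show ?thesis using False by (simp add: \<omega>_def mult.assoc[symmetric])
  qed
  then have "Re (k * \<omega>) = t" using False by (simp add: s_def)
  ultimately show ?thesis by blast
qed

text \<open>The displayed equation is the vanishing of the characteristic polynomial of the symbol
  at \<open>z\<close>. In the nontrivial case it reads z^2 - 2 (p a + Re (q b \<omega>)) z + 1 = 0;
  as |z| = 1, it suffices that Re (q b \<omega>) = Re z - p a, which some unit \<omega> achieves
  inside the band. In the trivial case it reads z^2 = 1 for every \<omega>, so \<omega> = 1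
  serves.\<close>

lemma exists_plane_wave:
  assumes w: "walk p q (\<lambda>_. A1) (\<lambda>_. A2) (\<lambda>_. B)" and z: "cmod z = 1" and I: "Re z \<in> I_set p q A1 A2 B"
  shows "\<exists>\<omega> v. plane_wave_data p q A1 A2 B z \<omega> v"
proof -
  interpret w: walk p q "\<lambda>_. A1" "\<lambda>_. A2" "\<lambda>_. B" by (rule w)
  have pq: "of_real p * of_real p + q * cnj q = (1::complex)"
    using arg_cong[OF w.pq, of complex_of_real] unfolding of_real_add complex_norm_square
    by (simp add: power2_eq_square)
  have AB: "of_real A1 * of_real A1 + B * cnj B = (1::complex)"
    using arg_cong[OF w.coin1, of complex_of_real] unfolding of_real_add complex_norm_square
    by (simp add: power2_eq_square)
  have zz: "z * cnj z = 1" using z by (simp add: complex_norm_square[symmetric])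
  have "\<exists>\<omega>. cmod \<omega> = 1 \<and>
    (of_real p * of_real A1 + q * \<omega> * B - z) * (cnj q * cnj \<omega> * cnj B - of_real p * of_real A2 - z)
    - (of_real p * cnj B + q * \<omega> * of_real A2) * (cnj q * cnj \<omega> * of_real A1 - of_real p * B) = 0"
  proof (cases "trivial_coin A1 A2 B")
    case True
    then have "B = 0" "A2 = A1" "A1 * A1 = 1" by (auto simp: trivial_coin_def)
    then have A: "B = 0" "A2 = A1" "of_real A1 * of_real A1 = (1::complex)"
      by (auto simp flip: of_real_mult)
    have "Re z = 1 \<or> Re z = - 1" using I True by (auto simp: I_set_def)
    then have "(Re z)\<^sup>2 = 1" by auto
    then have "Im z = 0" using cmod_power2[of z] z by simp
    then have "z * z = 1" using \<open>(Re z)\<^sup>2 = 1\<close> by (simp add: complex_eq_iff power2_eq_square)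
    have "(of_real p * of_real A1 - z) * (- (of_real p * of_real A1) - z) - q * of_real A1 * (cnj q * of_real A1)
        = z * z - (of_real A1 * of_real A1) * (of_real p * of_real p + q * cnj q)"
      by (simp add: algebra_simps)
    also have "\<dots> = 0" unfolding A pq \<open>z * z = 1\<close> by simp
    finally show ?thesis using A by (intro exI[of _ 1]) simp
  next
    case False
    then have A2: "A2 = - A1" using w.coin1 w.coin2 w.b_zero_or unfolding trivial_coin_def
      by (auto simp: power2_eq_1_iff)
    have "\<bar>Re z - p * A1\<bar> \<le> cmod (q * B)" using I False by (auto simp: I_set_def)
    then obtain \<omega> where \<omega>: "cmod \<omega> = 1" "Re (q * B * \<omega>) = Re z - p * A1"
      using exists_unit_with_Re by blast
    have ww: "\<omega> * cnj \<omega> = 1" using \<omega>(1) by (simp add: complex_norm_square[symmetric])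
    have "q * B * \<omega> + cnj (q * B * \<omega>) = of_real (2 * (Re z - p * A1))"
      unfolding complex_add_cnj \<omega>(2) ..
    also have "\<dots> = z + cnj z - 2 * (of_real p * of_real A1)" unfolding complex_add_cnj by simp
    finally have tr: "q * \<omega> * B + cnj q * cnj \<omega> * cnj B + 2 * (of_real p * of_real A1) = z + cnj z"
      by (simp add: algebra_simps)
    have "(of_real p * of_real A1 + q * \<omega> * B - z) * (cnj q * cnj \<omega> * cnj B + of_real p * of_real A1 - z)
        - (of_real p * cnj B - q * \<omega> * of_real A1) * (cnj q * cnj \<omega> * of_real A1 - of_real p * B)
      = (of_real p * of_real p + q * cnj q * (\<omega> * cnj \<omega>)) * (of_real A1 * of_real A1 + B * cnj B)
        - z * (q * \<omega> * B + cnj q * cnj \<omega> * cnj B + 2 * (of_real p * of_real A1)) + z * z"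
      by (simp add: algebra_simps)
    also have "\<dots> = 0" unfolding ww tr mult_1_right pq AB distrib_left zz by simp
    finally show ?thesis using A2 \<omega>(1) by (intro exI[of _ \<omega>]) simp
  qed
  then obtain \<omega> u v where "cmod \<omega> = 1" "(u, v) \<noteq> (0, 0)"
    "(of_real p * of_real A1 + q * \<omega> * B - z) * u + (of_real p * cnj B + q * \<omega> * of_real A2) * v = 0"
    "(cnj q * cnj \<omega> * of_real A1 - of_real p * B) * u + (cnj q * cnj \<omega> * cnj B - of_real p * of_real A2 - z) * v = 0"
    using exists_kernel_vector_2x2 by meson
  then have "plane_wave_data p q A1 A2 B z \<omega> (u, v)"
    unfolding plane_wave_data_def by (simp add: zero_prod_def algebra_simps)
  then show ?thesis by blast
qed

lemma constant_coin_spec: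
  assumes w: "walk p q (\<lambda>_. A1) (\<lambda>_. A2) (\<lambda>_. B)"
  shows "spec (Gam p q \<circ> Coin (\<lambda>_. A1) (\<lambda>_. A2) (\<lambda>_. B)) = {z. cmod z = 1 \<and> Re z \<in> I_set p q A1 A2 B}"
proof -
  interpret w: walk p q "\<lambda>_. A1" "\<lambda>_. A2" "\<lambda>_. B" by (rule w)
  have "\<not> bij (w.T z) \<longleftrightarrow> cmod z = 1 \<and> Re z \<in> I_set p q A1 A2 B" for z
  proof
    assume nb: "\<not> bij (w.T z)"
    then have z: "cmod z = 1" using w.bij_T_off_circle by blast
    moreover have "Re z \<in> I_set p q A1 A2 B"
    proof (rule ccontr)
      assume "Re z \<notin> I_set p q A1 A2 B"
      from constant_coin_bounded_below[OF w z this] have "w.bounded_below_at z"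
        by (simp add: w.bounded_below_at_def w.T_def)
      then show False using nb w.bij_iff_bounded_below by blast
    qed
    ultimately show "cmod z = 1 \<and> Re z \<in> I_set p q A1 A2 B" ..
  next
    assume z: "cmod z = 1 \<and> Re z \<in> I_set p q A1 A2 B"
    then obtain \<omega> v where "plane_wave_data p q A1 A2 B z \<omega> v" using exists_plane_wave[OF w] by blast
    \<comment> \<open>A constant coin is its own limit, so the criterion for limit coins applies to
      the model itself.\<close>
    then have "w.far_approx z"
      by (rule w.far_approx_if_plane_wave[OF w, where F = at_top]) (use z in auto)
    then show "\<not> bij (w.T z)" by (rule w.far_approx_imp_not_bij)
  qed
  then show ?thesis unfolding set_eq_iff mem_Collect_eq w.spec_iff by blast
qed

section \<open>Both inclusions for the essential spectrum\<close>

lemma walk_limit: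
  assumes w: "walk p q a1 a2 b" and F: "F \<noteq> bot"
    and lim: "(a1 \<longlongrightarrow> A1) F" "(a2 \<longlongrightarrow> A2) F" "(b \<longlongrightarrow> B) F"
  shows "walk p q (\<lambda>_. A1) (\<lambda>_. A2) (\<lambda>_. B)"
proof -
  interpret walk p q a1 a2 b by (rule w)
  have "((\<lambda>x. (a1 x)\<^sup>2 + (norm (b x))\<^sup>2) \<longlongrightarrow> A1\<^sup>2 + (norm B)\<^sup>2) F"
    "((\<lambda>x. (a2 x)\<^sup>2 + (norm (b x))\<^sup>2) \<longlongrightarrow> A2\<^sup>2 + (norm B)\<^sup>2) F"
    "((\<lambda>x. b x * complex_of_real (a1 x + a2 x)) \<longlongrightarrow> B * complex_of_real (A1 + A2)) F"
    by (intro tendsto_intros lim)+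
  then have "A1\<^sup>2 + (norm B)\<^sup>2 = 1" "A2\<^sup>2 + (norm B)\<^sup>2 = 1" "B * complex_of_real (A1 + A2) = 0"
    unfolding coin1 coin2 coin3 by (simp_all only: tendsto_const_iff[OF F])
  then show ?thesis using pq by unfold_locales auto
qed

lemma (in walk) limit_spec_subset_ess_spec:
  assumes F: "F = at_top \<or> F = at_bot" and lim: "(a1 \<longlongrightarrow> A1) F" "(a2 \<longlongrightarrow> A2) F" "(b \<longlongrightarrow> B) F"
  shows "spec (Gam p q \<circ> Coin (\<lambda>_. A1) (\<lambda>_. A2) (\<lambda>_. B)) \<subseteq> ess_spec (Gam p q \<circ> Coin a1 a2 b)"
proof
  have w: "walk p q (\<lambda>_. A1) (\<lambda>_. A2) (\<lambda>_. B)"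
    by (rule walk_limit[OF walk_axioms _ lim])
      (use F trivial_limit_at_top_linorder trivial_limit_at_bot_linorder in metis)
  fix z assume "z \<in> spec (Gam p q \<circ> Coin (\<lambda>_. A1) (\<lambda>_. A2) (\<lambda>_. B))"
  then have z: "cmod z = 1" "Re z \<in> I_set p q A1 A2 B" by (auto simp: constant_coin_spec[OF w])
  then obtain \<omega> v where "plane_wave_data p q A1 A2 B z \<omega> v" using exists_plane_wave[OF w] by blast
  then have "far_approx z" by (rule far_approx_if_plane_wave[OF w _ z(1) F lim])
  then show "z \<in> ess_spec (Gam p q \<circ> Coin a1 a2 b)"
    using far_approx_imp_not_bij far_approx_imp_not_disc z(1) by (simp add: ess_spec_def spec_iff)
qed

lemma (in walk) ess_spec_subset_limit_specs:
  assumes limL: "(a1 \<longlongrightarrow> A1) at_bot" "(a2 \<longlongrightarrow> A2) at_bot" "(b \<longlongrightarrow> B) at_bot"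
    and limR: "(a1 \<longlongrightarrow> A1') at_top" "(a2 \<longlongrightarrow> A2') at_top" "(b \<longlongrightarrow> B') at_top"
  shows "ess_spec (Gam p q \<circ> Coin a1 a2 b) \<subseteq> spec (Gam p q \<circ> Coin (\<lambda>_. A1) (\<lambda>_. A2) (\<lambda>_. B))
    \<union> spec (Gam p q \<circ> Coin (\<lambda>_. A1') (\<lambda>_. A2') (\<lambda>_. B'))"
proof (rule subsetI, rule ccontr)
  interpret L: walk p q "\<lambda>_. A1" "\<lambda>_. A2" "\<lambda>_. B" by (rule walk_limit[OF walk_axioms _ limL]) simp
  interpret R: walk p q "\<lambda>_. A1'" "\<lambda>_. A2'" "\<lambda>_. B'" by (rule walk_limit[OF walk_axioms _ limR]) simp
  fix z assume z: "z \<in> ess_spec (Gam p q \<circ> Coin a1 a2 b)"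
    and "z \<notin> spec (Gam p q \<circ> Coin (\<lambda>_. A1) (\<lambda>_. A2) (\<lambda>_. B))
      \<union> spec (Gam p q \<circ> Coin (\<lambda>_. A1') (\<lambda>_. A2') (\<lambda>_. B'))"
  then have "L.bounded_below_at z" "R.bounded_below_at z"
    by (auto simp: L.spec_iff R.spec_iff L.bij_iff_bounded_below R.bij_iff_bounded_below)
  then obtain cL cR where c: "cL > 0" "cR > 0" "\<And>\<psi>. cL * norm \<psi> \<le> norm (L.step \<psi> - sc z \<psi>)"
      "\<And>\<psi>. cR * norm \<psi> \<le> norm (R.step \<psi> - sc z \<psi>)"
    unfolding L.bounded_below_at_def R.bounded_below_at_def L.T_def R.T_def by blast
  define c where "c = min cL cR"
  have c0: "c > 0" using c by (simp add: c_def)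
  have "c * norm \<psi> \<le> norm (L.step \<psi> - sc z \<psi>)" "c * norm \<psi> \<le> norm (R.step \<psi> - sc z \<psi>)" for \<psi>
    using c(3,4)[of \<psi>] mult_right_mono[of c cL "norm \<psi>"] mult_right_mono[of c cR "norm \<psi>"]
    by (auto simp: c_def)
  from off_box_bound_from_limits[OF L.walk_axioms R.walk_axioms limL limR c0 this]
  obtain N where "off_box_bound (c / 4) N z" by blast
  then have "z \<in> disc_spec (Gam p q \<circ> Coin a1 a2 b)"
    by (rule disc_if_off_box_bound) (use z c0 in \<open>auto simp: ess_spec_def\<close>)
  then show False using z by (simp add: ess_spec_def)
qed

theorem theorem5p2:
  fixes p :: real and q :: complex
    and a1 a2 :: "int \<Rightarrow> real" and b :: "int \<Rightarrow> complex"
    and a1L a2L a1R a2R :: real and bL bR :: complex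
  assumes pq: "q \<noteq> 0" "p\<^sup>2 + (norm q)\<^sup>2 = 1"
    and coin1: "\<And>x. (a1 x)\<^sup>2 + (norm (b x))\<^sup>2 = 1"
    and coin2: "\<And>x. (a2 x)\<^sup>2 + (norm (b x))\<^sup>2 = 1"
    and coin3: "\<And>x. b x * complex_of_real (a1 x + a2 x) = 0"
    and limL: "(a1 \<longlongrightarrow> a1L) at_bot" "(a2 \<longlongrightarrow> a2L) at_bot" "(b \<longlongrightarrow> bL) at_bot"
    and limR: "(a1 \<longlongrightarrow> a1R) at_top" "(a2 \<longlongrightarrow> a2R) at_top" "(b \<longlongrightarrow> bR) at_top"
  shows "ess_spec (Gam p q \<circ> Coin a1 a2 b)
           = spec (Gam p q \<circ> Coin (\<lambda>_. a1L) (\<lambda>_. a2L) (\<lambda>_. bL))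
             \<union> spec (Gam p q \<circ> Coin (\<lambda>_. a1R) (\<lambda>_. a2R) (\<lambda>_. bR))
       \<and> spec (Gam p q \<circ> Coin (\<lambda>_. a1L) (\<lambda>_. a2L) (\<lambda>_. bL))
           = {z. cmod z = 1 \<and> Re z \<in> I_set p q a1L a2L bL}
       \<and> spec (Gam p q \<circ> Coin (\<lambda>_. a1R) (\<lambda>_. a2R) (\<lambda>_. bR))
           = {z. cmod z = 1 \<and> Re z \<in> I_set p q a1R a2R bR}"
proof -
  interpret walk p q a1 a2 b by (rule walk.intro) (fact pq(2) coin1 coin2 coin3)+
  have "walk p q (\<lambda>_. a1L) (\<lambda>_. a2L) (\<lambda>_. bL)" "walk p q (\<lambda>_. a1R) (\<lambda>_. a2R) (\<lambda>_. bR)"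
    using walk_limit[OF walk_axioms _ limL] walk_limit[OF walk_axioms _ limR] by simp_all
  then show ?thesis
    using ess_spec_subset_limit_specs[OF limL limR] limit_spec_subset_ess_spec[OF _ limL]
      limit_spec_subset_ess_spec[OF _ limR] constant_coin_spec
    by blast
qed

end
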